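(* Let $\pi\colon \mathrm{GL}(n)\to \mathrm{GL}(V)$ be a rational representation on a finite-dimensional complex vector space $V$ equipped with a $U(n)$-invariant Hermitian inner product with norm $\|\cdot\|$. Then for every $v\in V\setminus\{0\}$, $$1-\frac{\|\mu(v)\|_F}{\gamma(\pi)}\;\le\;\frac{\operatorname{cap}^2(v)}{\|v\|^2}\;\le\;1-\frac{\|\mu(v)\|_F^2}{4N(\pi)^2}.$$
   Context: All groups are over $\mathbb C$; $\mathrm{Herm}(n)$ is the space of Hermitian $n\times n$ matrices and $\|\cdot\|_F$ the Frobenius norm. Rational representation: a group homomorphism whose matrix entries are polynomials in the $g_{i,j}$ and $\det(g)^{-1}$. The inner product is such that $\pi(U(n))$ acts by unitary maps. Capacity: $\operatorname{cap}(v)=\inf_{g\in \mathrm{GL}(n)}\|\pi(g)v\|$. Moment map: $\mu\colon V\setminus\{0\}\to \mathrm{Herm}(n)$ is defined by $\operatorname{tr}[\mu(v)H]=\partial_{t=0}\log\|\pi(e^{tH})v\|$ for all $H\in\mathrm{Herm}(n)$. Weights: restricted to invertible diagonal matrices, $V=\bigoplus_{\omega\in\Omega(\pi)}V_\omega$, $V_\omega\neq 0$, where $\Omega(\pi)\subset\mathbb Z^n$ is finite and $\pi(\operatorname{diag}(x))w=\prod_i x_i^{\omega_i}\,w$ for $w\in V_\omega$. Weight norm: $N(\pi)=\max\{\|\lambda\|_2 : \lambda \text{ occurs in } \pi\}$, the maximum over the highest weights $\lambda\in\mathbb Z^n$ of the irreducible subrepresentations of $\pi$. Weight margin: $\gamma(\pi)$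 is the minimum Euclidean distance between the origin and $\operatorname{conv}(\Gamma)$, over all nonempty subsets $\Gamma\subseteq\Omega(\pi)$ with $0\notin\operatorname{conv}(\Gamma)$. Degenerate convention: if $\Omega(\pi)=\{0\}$ then $\mu\equiv0$, $\gamma(\pi)=+\infty$, $N(\pi)=0$, and the two fractions involving $\mu$ are read as $0$. *)

theory Defs
  imports "HOL-Analysis.Analysis"
begin

section \<open>Matrices\<close>

definition GL :: "(complex^'n^'n) set"
  where "GL = {g. invertible g}"

definition conj_transpose :: "complex^'n^'n \<Rightarrow> complex^'n^'n"
  where "conj_transpose A = map_matrix cnj (transpose A)"

definition unitary_group :: "(complex^'n^'n) set"
  where "unitary_group = {u. conj_transpose u ** u = mat 1 \<and> u ** conj_transpose u = mat 1}"

definition Herm :: "(complex^'n^'n) set"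
  where "Herm = {H. conj_transpose H = H}"

definition diag :: "complex^'n \<Rightarrow> complex^'n^'n"
  where "diag x = (\<chi> i j. if i = j then x $ i else 0)"

text \<open>The order on the index type only serves to single out the Borel subgroup with respect to
  which highest weights are taken.\<close>

definition borel_subgroup :: "(((complex, 'n::{finite,linorder}) vec, 'n) vec) set"
  where "borel_subgroup = {b \<in> GL. \<forall>i j. j < i \<longrightarrow> b $ i $ j = 0}"

text \<open>The library product on this type is entrywise, so neither \<^const>\<open>exp\<close> nor \<open>A ^ k\<close> is the matrix version.\<close>

definition mexp :: "complex^'n^'n \<Rightarrow> complex^'n^'n"
  where "mexp A = (\<Sum>k. (1 / fact k) *\<^sub>R (((\<lambda>B. A ** B) ^^ k) (mat 1)))"

section \<open>Rational representations with an invariant inner product\<close>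

locale hermitian_space =
  finite_dimensional_vector_space scaleV Basis
  for scaleV :: "complex \<Rightarrow> 'v::ab_group_add \<Rightarrow> 'v"
    and Basis :: "'v set" +
  fixes ip :: "'v \<Rightarrow> 'v \<Rightarrow> complex"
  assumes ip_add_left: "ip (x + y) z = ip x z + ip y z"
    and ip_scale_left: "ip (scaleV c x) y = c * ip x y"
    and ip_commute: "ip x y = cnj (ip y x)"
    and ip_pos: "x \<noteq> 0 \<Longrightarrow> Re (ip x x) > 0"

definition ipnorm :: "('v \<Rightarrow> 'v \<Rightarrow> complex) \<Rightarrow> 'v \<Rightarrow> real"
  where "ipnorm ip v = sqrt (Re (ip v v))"

text \<open>Polynomials in the matrix entries and the inverse of the determinant, as functions.\<close>

inductive gl_polynomial :: "(complex^'n^'n \<Rightarrow> complex) \<Rightarrow> bool"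
  where
    const: "gl_polynomial (\<lambda>g. c)"
  | entry: "gl_polynomial (\<lambda>g. g $ i $ j)"
  | inverse_det: "gl_polynomial (\<lambda>g. inverse (det g))"
  | add: "gl_polynomial p \<Longrightarrow> gl_polynomial q \<Longrightarrow> gl_polynomial (\<lambda>g. p g + q g)"
  | mult: "gl_polynomial p \<Longrightarrow> gl_polynomial q \<Longrightarrow> gl_polynomial (\<lambda>g. p g * q g)"

text \<open>The map \<open>\<pi>\<close> is total, but only its values on \<^const>\<open>GL\<close> are constrained (and used).
  The matrix entries of \<open>\<pi> g\<close> are taken with respect to \<open>Basis\<close>; the rationality condition does not
  depend on this choice.\<close>

locale unitary_rational_rep =
  hermitian_space scaleV Basis ip
  for scaleV :: "complex \<Rightarrow> 'v::ab_group_add \<Rightarrow> 'v"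
    and Basis :: "'v set"
    and ip :: "'v \<Rightarrow> 'v \<Rightarrow> complex" +
  fixes \<pi> :: "complex^'n^'n \<Rightarrow> 'v \<Rightarrow> 'v"
  assumes rep_linear: "g \<in> GL \<Longrightarrow> Vector_Spaces.linear scaleV scaleV (\<pi> g)"
    and rep_bij: "g \<in> GL \<Longrightarrow> bij (\<pi> g)"
    and rep_mult: "g \<in> GL \<Longrightarrow> h \<in> GL \<Longrightarrow> \<pi> (g ** h) = \<pi> g \<circ> \<pi> h"
    and rep_rational: "b \<in> Basis \<Longrightarrow> b' \<in> Basis \<Longrightarrow>
      \<exists>p. gl_polynomial p \<and> (\<forall>g\<in>GL. representation Basis (\<pi> g b) b' = p g)"
    and rep_unitary: "u \<in> unitary_group \<Longrightarrow> ip (\<pi> u x) (\<pi> u y) = ip x y"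

section \<open>Capacity and moment map\<close>

definition capacity ::
    "('v \<Rightarrow> 'v \<Rightarrow> complex) \<Rightarrow> (complex^'n^'n \<Rightarrow> 'v \<Rightarrow> 'v) \<Rightarrow> 'v \<Rightarrow> real"
  where "capacity ip \<pi> v = (INF g\<in>GL. ipnorm ip (\<pi> g v))"

definition moment_map ::
    "('v \<Rightarrow> 'v \<Rightarrow> complex) \<Rightarrow> (complex^'n^'n \<Rightarrow> 'v \<Rightarrow> 'v) \<Rightarrow> 'v \<Rightarrow> complex^'n^'n"
  where "moment_map ip \<pi> v =
    (THE M. M \<in> Herm \<and>
      (\<forall>H\<in>Herm. \<exists>d. trace (M ** H) = complex_of_real d \<and>
        ((\<lambda>t. ln (ipnorm ip (\<pi> (mexp (t *\<^sub>R H)) v))) has_real_derivative d) (at 0)))"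

section \<open>Weights\<close>

definition weight_space ::
    "(complex \<Rightarrow> 'v \<Rightarrow> 'v) \<Rightarrow> (complex^'n^'n \<Rightarrow> 'v \<Rightarrow> 'v) \<Rightarrow> int^'n \<Rightarrow> 'v set"
  where "weight_space scaleV \<pi> \<omega> =
    {w. \<forall>x. (\<forall>i. x $ i \<noteq> 0) \<longrightarrow> \<pi> (diag x) w = scaleV (\<Prod>i\<in>UNIV. (x $ i) powi (\<omega> $ i)) w}"

definition weights ::
    "(complex \<Rightarrow> 'v::zero \<Rightarrow> 'v) \<Rightarrow> (complex^'n^'n \<Rightarrow> 'v \<Rightarrow> 'v) \<Rightarrow> (int^'n) set"
  where "weights scaleV \<pi> = {\<omega>. \<exists>w\<in>weight_space scaleV \<pi> \<omega>. w \<noteq> 0}"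

definition real_weight :: "int^'n \<Rightarrow> real^'n"
  where "real_weight \<omega> = (\<chi> i. real_of_int (\<omega> $ i))"

text \<open>The value is \<open>\<infinity>\<close> if no admissible \<open>\<Gamma>\<close> exists, i.e. if \<open>0\<close> is the only weight.  Otherwise the
  infimum is a minimum, as there are only finitely many weights.\<close>

definition weight_margin ::
    "(complex \<Rightarrow> 'v::zero \<Rightarrow> 'v) \<Rightarrow> (complex^'n^'n \<Rightarrow> 'v \<Rightarrow> 'v) \<Rightarrow> ereal"
  where "weight_margin scaleV \<pi> =
    (INF \<Gamma> \<in> {\<Gamma>. \<Gamma> \<subseteq> weights scaleV \<pi> \<and> \<Gamma> \<noteq> {} \<and> 0 \<notin> convex hull (real_weight ` \<Gamma>)}.
      ereal (infdist 0 (convex hull (real_weight ` \<Gamma>))))"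

definition subrepresentation ::
    "(complex \<Rightarrow> 'v::ab_group_add \<Rightarrow> 'v) \<Rightarrow> (complex^'n^'n \<Rightarrow> 'v \<Rightarrow> 'v) \<Rightarrow> 'v set \<Rightarrow> bool"
  where "subrepresentation scaleV \<pi> W \<longleftrightarrow>
    module.subspace scaleV W \<and> (\<forall>g\<in>GL. \<pi> g ` W \<subseteq> W)"

definition irreducible_subrep ::
    "(complex \<Rightarrow> 'v::ab_group_add \<Rightarrow> 'v) \<Rightarrow> (complex^'n^'n \<Rightarrow> 'v \<Rightarrow> 'v) \<Rightarrow> 'v set \<Rightarrow> bool"
  where "irreducible_subrep scaleV \<pi> W \<longleftrightarrow>
    subrepresentation scaleV \<pi> W \<and> W \<noteq> {0} \<and>
    (\<forall>W'. subrepresentation scaleV \<pi> W' \<and> W' \<subseteq> W \<longrightarrow> W' = {0} \<or> W' = W)"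

text \<open>A highest weight vector is an eigenvector of the Borel subgroup; its weight is the character
  of the diagonal part.\<close>

definition is_highest_weight ::
    "(complex \<Rightarrow> 'v::ab_group_add \<Rightarrow> 'v) \<Rightarrow> (((complex, 'n::{finite,linorder}) vec, 'n) vec \<Rightarrow> 'v \<Rightarrow> 'v)
      \<Rightarrow> 'v set \<Rightarrow> (int, 'n) vec \<Rightarrow> bool"
  where "is_highest_weight scaleV \<pi> W l \<longleftrightarrow>
    (\<exists>w\<in>W. w \<noteq> 0 \<and>
      (\<forall>b\<in>borel_subgroup. \<pi> b w = scaleV (\<Prod>i\<in>UNIV. (b $ i $ i) powi (l $ i)) w))"

text \<open>The set is finite and, if the space is nonzero, nonempty.\<close>

definition weight_norm ::
    "(complex \<Rightarrow> 'v::ab_group_add \<Rightarrow> 'v) \<Rightarrow> (((complex, 'n::{finite,linorder}) vec, 'n) vec \<Rightarrow> 'v \<Rightarrow> 'v) \<Rightarrow> real"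
  where "weight_norm scaleV \<pi> =
    Max {norm (real_weight l) | l. \<exists>W. irreducible_subrep scaleV \<pi> W \<and> is_highest_weight scaleV \<pi> W l}"

end

theory Submission
  imports Defs
begin

text \<open>
  Both inequalities reduce to weighted sums of exponentials. By the singular value decomposition
  every \<open>g\<close> is \<open>k diag(exp h) u\<^sup>*\<close> with \<open>k\<close>, \<open>u\<close> unitary and \<open>h\<close> real. The
  representation is unitary on \<open>k\<close>, and the weight spaces are pairwise orthogonal, so with
  \<open>p \<omega>\<close> the squared length of the component of \<open>\<pi>(u\<^sup>*) v\<close> of weight \<open>\<omega>\<close> one gets
  \<open>\<parallel>\<pi>(g) v\<parallel>\<^sup>2 = \<Sum>\<^sub>\<omega> p \<omega> exp (2 \<langle>\<omega>, h\<rangle>)\<close>, see \<open>norm_orbit\<close>. Differentiating the same formula identifies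
  the mean weight \<open>(\<Sum>\<^sub>\<omega> p \<omega> \<omega>) / \<parallel>v\<parallel>\<^sup>2\<close> with the diagonal of \<open>u\<^sup>* \<mu>(v) u\<close>, see \<open>moment_map_weights\<close>;
  in particular its length is at most \<open>\<parallel>\<mu>(v)\<parallel>\<close>, with equality if \<open>u\<close> diagonalizes \<open>\<mu>(v)\<close>.

  Lower bound. Remove from \<open>p\<close> as large as possible a part whose weighted sum of weights is \<open>0\<close>. By
  \<open>exp x \<ge> 1 + x\<close> this part contributes at least its mass to the sum of exponentials. What is left
  is supported on a set \<open>\<Gamma>\<close> with \<open>0 \<notin> conv \<Gamma>\<close>, so its mass is at most \<open>1 / \<gamma>\<close> times the length of its
  weighted sum of weights, which is the one of \<open>p\<close>. This is \<open>exp_sum_lower_bound\<close>; it bounds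
  \<open>\<parallel>\<pi>(g) v\<parallel>\<close> for all \<open>g\<close> at once.

  Upper bound. Diagonalize \<open>\<mu>(v)\<close> and move along the one-parameter subgroup generated by \<open>- \<mu>(v)\<close>. If
  all weights have length at most \<open>N\<close>, convexity of \<open>exp\<close> bounds the sum of exponentials by
  \<open>\<parallel>v\<parallel>\<^sup>2 ((1 + x) / (2 r) + (1 - x) r / 2)\<close>, where \<open>x = \<parallel>\<mu>(v)\<parallel> / N\<close> and \<open>r \<ge> 1\<close> depends on
  the time. The choice \<open>r = 1 + x\<close> gives \<open>1 - x\<^sup>2 / 2\<close>, which is at most \<open>1 - x\<^sup>2 / 4\<close>.

  It remains to compare \<open>N\<close> with the highest weights (\<open>weight_norm_bound\<close>). A weight of maximal length
  can be chosen dominant, because swapping coordinates preserves the set of weights. Its weight vectors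
  are then fixed by every upper triangular transvection: the other terms of the orbit
  would have weights \<open>\<omega> + k (e\<^sub>i - e\<^sub>j)\<close> with \<open>k > 0\<close>, and these are longer. So they are highest
  weight vectors, and a subrepresentation of least dimension containing one of them is irreducible, because
  orthogonal complements of subrepresentations are subrepresentations.
\<close>


section \<open>Matrices\<close>

lemma conj_transpose_component [simp]: "conj_transpose A $ i $ j = cnj (A $ j $ i)"
  by (simp add: conj_transpose_def map_matrix_def transpose_def)

lemma conj_transpose_involution [simp]: "conj_transpose (conj_transpose A) = A"
  by (simp add: vec_eq_iff)

lemma conj_transpose_mult: "conj_transpose (A ** B) = conj_transpose B ** conj_transpose A"
  by (simp add: vec_eq_iff matrix_matrix_mult_def mult.commute)

lemma conj_transpose_mat_1 [simp]: "conj_transpose (mat 1) = mat 1"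
  by (simp add: vec_eq_iff mat_def)

lemma Herm_iff: "A \<in> Herm \<longleftrightarrow> (\<forall>i j. A $ i $ j = cnj (A $ j $ i))"
  by (simp add: Herm_def vec_eq_iff eq_commute)

lemma matrix_mult_diag_component [simp]: "(A ** diag x) $ i $ j = A $ i $ j * x $ j"
  by (simp add: matrix_matrix_mult_def diag_def if_distrib cong: if_cong)

lemma diag_matrix_mult_component [simp]: "(diag x ** A) $ i $ j = x $ i * A $ i $ j"
  by (simp add: matrix_matrix_mult_def diag_def if_distrib[of "\<lambda>c. c * _"] cong: if_cong)

lemma diag_component: "diag x $ i $ j = (if i = j then x $ i else 0)"
  by (simp add: diag_def)

lemma diag_mult: "diag x ** diag y = diag (x * y)"
  by (simp add: vec_eq_iff diag_component)

lemma diag_1 [simp]: "diag 1 = mat 1"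
  by (simp add: vec_eq_iff diag_component mat_def)

lemma diag_in_GL: assumes "\<And>i. x $ i \<noteq> 0" shows "diag x \<in> GL"
proof -
  have "diag x ** diag (\<chi> i. inverse (x $ i)) = mat 1" "diag (\<chi> i. inverse (x $ i)) ** diag x = mat 1"
    using assms by (simp_all add: vec_eq_iff diag_component mat_def)
  then show ?thesis unfolding GL_def invertible_def by blast
qed

lemma GL_mult: "g \<in> GL \<Longrightarrow> h \<in> GL \<Longrightarrow> g ** h \<in> GL"
  using invertible_mult[of g h] unfolding GL_def by simp

lemma mat_1_in_GL [simp]: "mat 1 \<in> GL"
  using diag_in_GL[of 1] by simp

lemma unitary_in_GL: "u \<in> unitary_group \<Longrightarrow> u \<in> GL"
  unfolding GL_def invertible_def unitary_group_def by blast

lemma unitary_conj_transpose: "u \<in> unitary_group \<Longrightarrow> conj_transpose u \<in> unitary_group"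
  by (auto simp: unitary_group_def)

lemma unitaryI: "conj_transpose u ** u = mat 1 \<Longrightarrow> u \<in> unitary_group"
  unfolding unitary_group_def using matrix_left_right_inverse[of "conj_transpose u" u] by blast

text \<open>The real inner product of complex matrices is the real part of the Frobenius
  product, so \<^const>\<open>norm\<close> is the Frobenius norm.\<close>
lemma inner_complex_matrix: "A \<bullet> B = Re (trace (conj_transpose A ** B))"
  for A B :: "complex^'n^'n"
proof -
  have "A \<bullet> B = (\<Sum>i\<in>UNIV. \<Sum>j\<in>UNIV. Re (cnj (A $ i $ j) * B $ i $ j))"
    by (simp add: inner_vec_def inner_complex_def)
  also have "\<dots> = (\<Sum>j\<in>UNIV. \<Sum>i\<in>UNIV. Re (cnj (A $ i $ j) * B $ i $ j))"
    by (rule sum.swap)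
  finally show ?thesis
    by (simp add: trace_def matrix_matrix_mult_def)
qed

section \<open>Spectral theorem and singular values\<close>

definition hdot :: "complex^'n \<Rightarrow> complex^'n \<Rightarrow> complex"
  where "hdot x y = (\<Sum>i\<in>UNIV. x $ i * cnj (y $ i))"

lemma Re_hdot: "Re (hdot x y) = x \<bullet> y"
  by (simp add: hdot_def inner_vec_def inner_complex_def)

lemma hdot_commute: "hdot x y = cnj (hdot y x)"
  by (simp add: hdot_def mult.commute)

lemma hdot_linear:
  "hdot (x + y) z = hdot x z + hdot y z" "hdot (x - y) z = hdot x z - hdot y z"
  "hdot (r *\<^sub>R x) z = of_real r * hdot x z" "hdot x (r *\<^sub>R z) = of_real r * hdot x z"
  by (simp_all add: hdot_def algebra_simps sum.distrib sum_subtractf sum_distrib_left scaleR_conv_of_real[where 'a=complex])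

lemma hdot_Herm:
  assumes "A \<in> Herm" shows "hdot (A *v x) y = hdot x (A *v y)"
proof -
  have "hdot (A *v x) y = (\<Sum>i\<in>UNIV. \<Sum>j\<in>UNIV. A $ i $ j * x $ j * cnj (y $ i))"
    by (simp add: hdot_def matrix_vector_mult_def sum_distrib_right)
  also have "\<dots> = (\<Sum>j\<in>UNIV. \<Sum>i\<in>UNIV. A $ i $ j * x $ j * cnj (y $ i))"
    by (rule sum.swap)
  also have "\<dots> = (\<Sum>j\<in>UNIV. \<Sum>i\<in>UNIV. x $ j * cnj (A $ j $ i * y $ i))"
  proof (rule sum.cong[OF refl], rule sum.cong[OF refl])
    fix i j
    have "A $ i $ j = cnj (A $ j $ i)" using assms unfolding Herm_iff by blast
    then show "A $ i $ j * x $ j * cnj (y $ i) = x $ j * cnj (A $ j $ i * y $ i)"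
      by (metis complex_cnj_mult mult.assoc mult.commute)
  qed
  also have "\<dots> = hdot x (A *v y)"
    by (simp add: hdot_def matrix_vector_mult_def sum_distrib_left)
  finally show ?thesis .
qed

lemma matrix_vector_mult_scaleR_complex: "(A :: complex^'n^'n) *v (r *\<^sub>R x) = r *\<^sub>R (A *v x)"
  by (simp add: vec_eq_iff matrix_vector_mult_def scaleR_sum_right)

text \<open>As a real space \<open>\<complex>\<^sup>n\<close> has dimension \<open>2n\<close>, and complex orthogonality to \<open>e\<close> is
  real orthogonality to both \<open>e\<close> and \<open>\<i> e\<close>.\<close>
lemma orthogonal_vector_exists:
  fixes E :: "(complex^'n) set"
  assumes "finite E" "card E < CARD('n)"
  obtains x where "x \<noteq> 0" "\<forall>e\<in>E. hdot x e = 0"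
proof -
  let ?F = "E \<union> (\<lambda>e. \<i> *s e) ` E"
  have "dim ?F \<le> card ?F" using assms by (intro dim_le_card') auto
  also have "\<dots> \<le> card E + card E"
    using card_Un_le[of E "(\<lambda>e. \<i> *s e) ` E"] card_image_le[OF assms(1), of "\<lambda>e. \<i> *s e"] by linarith
  also have "\<dots> < DIM(complex^'n)" using assms by simp
  finally obtain x where x: "x \<noteq> 0" "\<And>y. y \<in> span ?F \<Longrightarrow> orthogonal x y"
    using orthogonal_to_subspace_exists by blast
  have "hdot x e = 0" if "e \<in> E" for e
  proof (rule complex_eqI)
    show "Re (hdot x e) = Re 0"
      using x(2)[OF span_base, of e] that by (simp add: Re_hdot orthogonal_def)
    have "Re (hdot x (\<i> *s e)) = 0"
      using x(2)[OF span_base, of "\<i> *s e"] that by (simp add: Re_hdot orthogonal_def)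
    also have "hdot x (\<i> *s e) = - \<i> * hdot x e"
      by (simp add: hdot_def sum_distrib_left sum_negf mult_ac)
    finally show "Im (hdot x e) = Im 0" by simp
  qed
  then show ?thesis using x(1) that by blast
qed

lemma nonneg_quadratic_imp_linear_coeff_0:
  fixes b c :: real
  assumes "\<And>t. 0 \<le> 2 * t * b + t\<^sup>2 * c" "0 \<le> c"
  shows "b = 0"
proof (rule ccontr)
  assume b: "b \<noteq> 0"
  have "2 * (- b / (c + 1)) * b + (- b / (c + 1))\<^sup>2 * c = - (b\<^sup>2 * (c + 2)) / (c + 1)\<^sup>2"
    using assms(2) by (simp add: divide_simps) (simp add: power2_eq_square algebra_simps)
  moreover have "0 < b\<^sup>2 * (c + 2) / (c + 1)\<^sup>2" using b assms(2) by (intro divide_pos_pos) auto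
  ultimately show False using assms(1)[of "- b / (c + 1)"] by simp
qed

text \<open>The Rayleigh quotient of \<open>A\<close> attains its maximum \<open>c\<close> on the unit sphere of the orthogonal
  complement \<open>W\<close> of the given eigenvectors. The form of \<open>B = c - A\<close> is nonnegative on \<open>W\<close> and vanishes
  at the maximizer \<open>x\<close>, so its first variation there vanishes as well; as \<open>B x\<close> lies in \<open>W\<close>, it is \<open>0\<close>.\<close>
lemma Herm_eigenvector_orthogonal:
  fixes A :: "complex^'n^'n"
  assumes A: "A \<in> Herm" and E: "finite E" "card E < CARD('n)"
    and eig: "\<And>e. e \<in> E \<Longrightarrow> \<exists>c::real. A *v e = c *\<^sub>R e"
  obtains x c where "norm x = 1" "\<forall>e\<in>E. hdot x e = 0" "A *v x = c *\<^sub>R x"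
proof -
  define W where "W = {x. \<forall>e\<in>E. hdot x e = 0}"
  have W_lin: "x + y \<in> W" "x - y \<in> W" "r *\<^sub>R x \<in> W" if "x \<in> W" "y \<in> W" for x y r
    using that by (auto simp: W_def hdot_linear)
  have AW: "A *v x \<in> W" if "x \<in> W" for x
  proof -
    have "hdot (A *v x) e = 0" if "e \<in> E" for e
      using eig[OF that] \<open>x \<in> W\<close> that by (auto simp: hdot_Herm[OF A] hdot_linear W_def)
    then show ?thesis by (simp add: W_def)
  qed
  have cont: "continuous_on UNIV (\<lambda>x. (A *v x) \<bullet> x)"
    unfolding matrix_vector_mult_def inner_vec_def by (simp, intro continuous_intros)
  have "closed W"
  proof -
    have "closed {x. hdot x e = 0}" for e :: "complex^'n"
      unfolding hdot_def by (intro closed_Collect_eq continuous_intros)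
    moreover have "W = (\<Inter>e\<in>E. {x. hdot x e = 0})" by (auto simp: W_def)
    ultimately show ?thesis by auto
  qed
  then have comp: "compact (sphere 0 1 \<inter> W)" by (intro compact_Int_closed) auto
  obtain x0 where x0: "x0 \<noteq> 0" "x0 \<in> W"
    using orthogonal_vector_exists[OF E] unfolding W_def by blast
  then have "(1 / norm x0) *\<^sub>R x0 \<in> sphere 0 1 \<inter> W" using W_lin(3)[of x0 x0] by simp
  then obtain x where x: "x \<in> sphere 0 1 \<inter> W"
    and max: "\<And>y. y \<in> sphere 0 1 \<inter> W \<Longrightarrow> (A *v y) \<bullet> y \<le> (A *v x) \<bullet> x"
    using continuous_attains_sup[OF comp _ continuous_on_subset[OF cont]] by blast
  define c where "c = (A *v x) \<bullet> x"
  define B where "B y = c *\<^sub>R y - A *v y" for y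
  have BW: "B y \<in> W" if "y \<in> W" for y
    using that by (auto simp: B_def intro!: W_lin AW)
  have B_sym: "B y \<bullet> z = y \<bullet> B z" for y z
    using arg_cong[OF hdot_Herm[OF A, of y z], of Re]
    by (simp add: B_def inner_diff_left inner_diff_right Re_hdot)
  have B_lin: "B (y + t *\<^sub>R z) = B y + t *\<^sub>R B z" for y z t
    by (simp add: B_def matrix_vector_right_distrib matrix_vector_mult_scaleR_complex algebra_simps)
  have B_pos: "0 \<le> B y \<bullet> y" if "y \<in> W" for y
  proof (cases "y = 0")
    case False
    then have "(1 / norm y) *\<^sub>R y \<in> sphere 0 1 \<inter> W" using W_lin(3)[of y y] that by simp
    from max[OF this] have "((A *v y) \<bullet> y) / (norm y)\<^sup>2 \<le> c"
      by (simp add: c_def matrix_vector_mult_scaleR_complex power2_eq_square)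
    then have "(A *v y) \<bullet> y \<le> c * (norm y)\<^sup>2" using False by (simp add: divide_simps)
    then show ?thesis by (simp add: B_def inner_diff_left power2_norm_eq_inner)
  qed simp
  have Bx: "B x \<bullet> x = 0"
    using x by (simp add: B_def inner_diff_left c_def flip: power2_norm_eq_inner)
  have "B x \<bullet> y = 0" if y: "y \<in> W" for y
  proof (rule nonneg_quadratic_imp_linear_coeff_0)
    fix t
    have "x + t *\<^sub>R y \<in> W" using x y by (auto intro!: W_lin)
    from B_pos[OF this] show "0 \<le> 2 * t * (B x \<bullet> y) + t\<^sup>2 * (B y \<bullet> y)"
      using Bx B_sym[of y x]
      by (simp add: B_lin inner_add_left inner_add_right power2_eq_square inner_commute algebra_simps)
  qed (use B_pos y in auto)
  then have "B x = 0" using BW x by (metis IntD2 inner_eq_zero_iff)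
  then show ?thesis using x that[of x c] by (simp add: B_def W_def)
qed

text \<open>Eigenvectors are added one index at a time; quantifying over subsets \<open>I\<close> of the index type
  makes this an induction with the dimension fixed.\<close>
lemma Herm_orthonormal_eigenvectors:
  fixes A :: "complex^'n^'n" and I :: "'n set"
  assumes A: "A \<in> Herm"
  shows "\<exists>e c. (\<forall>i\<in>I. A *v e i = (c i :: real) *\<^sub>R e i) \<and>
     (\<forall>i\<in>I. \<forall>j\<in>I. hdot (e i) (e j) = (if i = j then 1 else 0))"
  using finite[of I]
proof (induction I rule: finite_induct)
  case (insert k I)
  then obtain e and c :: "'n \<Rightarrow> real" where e: "\<forall>i\<in>I. A *v e i = c i *\<^sub>R e i"
     "\<forall>i\<in>I. \<forall>j\<in>I. hdot (e i) (e j) = (if i = j then 1 else 0)" by blast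
  have "card (e ` I) \<le> card I" by (rule card_image_le) simp
  also have "\<dots> < CARD('n)" using insert.hyps by (intro psubset_card_mono) auto
  finally have card: "card (e ` I) < CARD('n)" .
  have eig: "\<exists>d::real. A *v y = d *\<^sub>R y" if "y \<in> e ` I" for y using e(1) that by auto
  obtain x d where x: "norm x = 1" "\<forall>y\<in>e ` I. hdot x y = 0" "A *v x = d *\<^sub>R x"
    by (rule Herm_eigenvector_orthogonal[OF A _ card eig]) auto
  have "Im (hdot x x) = 0" by (simp add: hdot_def mult.commute)
  then have "hdot x x = 1"
    using x(1) by (simp add: complex_eq_iff Re_hdot norm_eq_1)
  moreover have "hdot y x = 0" if "y \<in> e ` I" for y
    using bspec[OF x(2) that] by (subst hdot_commute) simp
  ultimately show ?case using e x(2,3) insert.hyps(2)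
    by (intro exI[of _ "e(k := x)"] exI[of _ "c(k := d)"] conjI ballI)
       (simp_all, (metis imageI insert_iff)+)
qed simp

text \<open>The Hermitian matrix with spectrum \<open>d\<close> whose eigenvectors are the columns of the unitary \<open>u\<close>.
  Every Hermitian matrix has this form, and for fixed \<open>u\<close> these matrices commute, so the matrix exponential
  acts on \<open>d\<close> coordinatewise.\<close>
definition eigen_matrix :: "complex^'n^'n \<Rightarrow> real^'n \<Rightarrow> complex^'n^'n"
  where "eigen_matrix u d = u ** diag (\<chi> i. complex_of_real (d $ i)) ** conj_transpose u"

theorem Herm_diagonalizable:
  fixes A :: "complex^'n^'n"
  assumes A: "A \<in> Herm"
  obtains u d where "u \<in> unitary_group" "A = eigen_matrix u d"
proof -
  obtain e and c :: "'n \<Rightarrow> real" where e: "\<And>i. A *v e i = c i *\<^sub>R e i"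
     "\<And>i j. hdot (e i) (e j) = (if i = j then 1 else 0)"
    using Herm_orthonormal_eigenvectors[OF A, of UNIV] unfolding ball_UNIV by blast
  define u :: "complex^'n^'n" where "u = (\<chi> r j. e j $ r)"
  have "conj_transpose u ** u = mat 1"
    using e(2) by (simp add: vec_eq_iff matrix_matrix_mult_def u_def hdot_def mat_def mult.commute)
  then have u: "u \<in> unitary_group" by (rule unitaryI)
  have "A ** u = u ** diag (\<chi> i. complex_of_real (c i))"
  proof -
    have "(A ** u) $ r $ j = u $ r $ j * complex_of_real (c j)" for r j
      using arg_cong[OF e(1)[of j], of "\<lambda>x. x $ r"]
      by (simp add: matrix_matrix_mult_def matrix_vector_mult_def u_def scaleR_conv_of_real[where 'a=complex] mult.commute)
    then show ?thesis by (simp add: vec_eq_iff)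
  qed
  then have "A ** u ** conj_transpose u = eigen_matrix u (\<chi> i. c i)" by (simp add: eigen_matrix_def)
  moreover have "A ** u ** conj_transpose u = A"
    using u by (simp add: unitary_group_def flip: matrix_mul_assoc)
  ultimately show ?thesis using u that by metis
qed

lemma eigen_matrix_component: "eigen_matrix u d $ i $ j = (\<Sum>k\<in>UNIV. d $ k *\<^sub>R (u $ i $ k * cnj (u $ j $ k)))"
  unfolding eigen_matrix_def matrix_matrix_mult_def[of _ "conj_transpose u"]
  by (simp add: scaleR_conv_of_real mult_ac)

lemma eigen_matrix_Herm: "eigen_matrix u d \<in> Herm"
  by (simp add: Herm_iff eigen_matrix_component mult.commute)

lemma eigen_matrix_mult: assumes "u \<in> unitary_group" shows "eigen_matrix u d ** eigen_matrix u d' = eigen_matrix u (d * d')"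
proof -
  let ?D = "\<lambda>d. diag (\<chi> i. complex_of_real (d $ i))"
  have "eigen_matrix u d ** eigen_matrix u d' = u ** (?D d ** (conj_transpose u ** u) ** ?D d') ** conj_transpose u"
    unfolding eigen_matrix_def by (simp only: matrix_mul_assoc)
  also have "?D d ** (conj_transpose u ** u) ** ?D d' = ?D (d * d')"
    using assms by (simp add: unitary_group_def diag_mult) (simp add: vec_eq_iff diag_component)
  finally show ?thesis by (simp add: eigen_matrix_def)
qed

lemma eigen_matrix_1: 
  fixes u :: "complex^'n^'n"
  assumes "u \<in> unitary_group" shows "eigen_matrix u 1 = mat 1"
proof -
  have "(\<chi> i. complex_of_real ((1::real^'n) $ i)) = 1" by (simp add: vec_eq_iff)
  then show ?thesis using assms by (simp add: eigen_matrix_def unitary_group_def)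
qed

lemma inner_eigen_matrix:
  assumes u: "u \<in> unitary_group" shows "eigen_matrix u d \<bullet> eigen_matrix u d' = d \<bullet> d'"
proof -
  have "eigen_matrix u d \<bullet> eigen_matrix u d' = Re (trace (eigen_matrix u (d * d')))"
    using eigen_matrix_Herm[of u d] u by (simp add: inner_complex_matrix Herm_def eigen_matrix_mult)
  also have "eigen_matrix u (d * d') = u ** (diag (\<chi> i. complex_of_real ((d * d') $ i)) ** conj_transpose u)"
    by (simp add: eigen_matrix_def matrix_mul_assoc)
  also have "trace \<dots> = trace (diag (\<chi> i. complex_of_real ((d * d') $ i)) ** (conj_transpose u ** u))"
    by (subst trace_mul_sym) (simp add: matrix_mul_assoc)
  also have "Re \<dots> = d \<bullet> d'" using u by (simp add: unitary_group_def trace_def diag_component inner_vec_def)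
  finally show ?thesis .
qed

lemma norm_eigen_matrix: "u \<in> unitary_group \<Longrightarrow> norm (eigen_matrix u d) = norm d"
  by (simp add: norm_eq_sqrt_inner inner_eigen_matrix)

lemma scaleR_eigen_matrix: "t *\<^sub>R eigen_matrix u d = eigen_matrix u (t *\<^sub>R d)"
  by (simp add: vec_eq_iff eigen_matrix_component scaleR_sum_right)

lemma eigen_matrix_power:
  fixes d :: "real^'n"
  assumes u: "u \<in> unitary_group"
  shows "((\<lambda>B. eigen_matrix u d ** B) ^^ k) (mat 1) = eigen_matrix u (\<chi> i. (d $ i) ^ k)"
proof (induction k)
  case 0
  have "(\<chi> i. (d $ i) ^ 0) = (1 :: real^'n)" by (simp add: vec_eq_iff)
  then show ?case using u by (simp add: eigen_matrix_1)
next
  case (Suc k)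
  have "d * (\<chi> i. (d $ i) ^ k) = (\<chi> i. (d $ i) ^ Suc k)" by (simp add: vec_eq_iff)
  then show ?case using Suc u by (simp add: eigen_matrix_mult)
qed

lemma sums_matrixI: "(\<And>i j. (\<lambda>k. f k $ i $ j) sums (l $ i $ j)) \<Longrightarrow> f sums (l :: complex^'n^'n)"
  unfolding sums_def by (intro vec_tendstoI) simp

lemma mexp_eigen_matrix:
  assumes u: "u \<in> unitary_group"
  shows "mexp (eigen_matrix u d) = eigen_matrix u (\<chi> i. exp (d $ i))"
proof -
  have "(\<lambda>k. (1 / fact k) *\<^sub>R eigen_matrix u (\<chi> i. (d $ i) ^ k)) sums eigen_matrix u (\<chi> i. exp (d $ i))"
  proof (rule sums_matrixI)
    fix i j
    have "(\<lambda>k. \<Sum>l\<in>UNIV. (d $ l ^ k /\<^sub>R fact k) *\<^sub>R (u $ i $ l * cnj (u $ j $ l)))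
        sums (\<Sum>l\<in>UNIV. exp (d $ l) *\<^sub>R (u $ i $ l * cnj (u $ j $ l)))"
      by (intro sums_sum sums_scaleR_left exp_converges)
    then show "(\<lambda>k. ((1 / fact k) *\<^sub>R eigen_matrix u (\<chi> i. (d $ i) ^ k)) $ i $ j) sums
        (eigen_matrix u (\<chi> i. exp (d $ i)) $ i $ j)"
      by (simp add: eigen_matrix_component scaleR_sum_right divide_inverse mult.commute)
  qed
  then show ?thesis unfolding mexp_def eigen_matrix_power[OF u] by (rule sums_unique[symmetric])
qed

lemma mexp_scaleR_eigen_matrix:
  "u \<in> unitary_group \<Longrightarrow> mexp (t *\<^sub>R eigen_matrix u d) = eigen_matrix u (\<chi> i. exp (t * d $ i))"
  by (simp add: scaleR_eigen_matrix mexp_eigen_matrix)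

text \<open>With \<open>g\<^sup>* g = u diag(d) u\<^sup>*\<close> all \<open>d\<^sub>j\<close> are positive, being squared lengths of the columns of the
  invertible matrix \<open>g u\<close>, and \<open>k = g u diag(d)\<^sup>-\<^sup>1\<^sup>/\<^sup>2\<close> is unitary.\<close>
lemma singular_value_decomposition:
  fixes g :: "complex^'n^'n"
  assumes g: "g \<in> GL"
  obtains k h u where "k \<in> unitary_group" "u \<in> unitary_group"
    "g = k ** diag (\<chi> i. of_real (exp (h $ i))) ** conj_transpose u"
proof -
  have "conj_transpose g ** g \<in> Herm" by (simp add: Herm_def conj_transpose_mult)
  then obtain u d where u: "u \<in> unitary_group" and gg: "conj_transpose g ** g = eigen_matrix u d"
    by (rule Herm_diagonalizable)
  have uu: "conj_transpose u ** u = mat 1" "u ** conj_transpose u = mat 1"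
    using u by (auto simp: unitary_group_def)
  define D where "D x = diag (\<chi> i. complex_of_real (x $ i))" for x :: "real^'n"
  have "conj_transpose (g ** u) ** (g ** u) = conj_transpose u ** (conj_transpose g ** g) ** u"
    by (simp add: conj_transpose_mult matrix_mul_assoc)
  also have "\<dots> = (conj_transpose u ** u) ** D d ** (conj_transpose u ** u)"
    by (simp only: gg eigen_matrix_def matrix_mul_assoc D_def)
  finally have gu: "conj_transpose (g ** u) ** (g ** u) = D d" by (simp add: uu)
  have pos: "d $ j > 0" for j
  proof -
    have "g ** u \<in> GL" using g u by (simp add: GL_mult unitary_in_GL)
    then have "det (g ** u) \<noteq> 0" by (simp add: GL_def invertible_det_nz)
    then obtain i where i: "(g ** u) $ i $ j \<noteq> 0"
      using det_zero_column(1)[of j "g ** u"] by (auto simp: column_def vec_eq_iff)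
    have "complex_of_real (d $ j) = (\<Sum>i\<in>UNIV. cnj ((g ** u) $ i $ j) * (g ** u) $ i $ j)"
      using arg_cong[OF gu, of "\<lambda>M. M $ j $ j"]
      by (simp add: matrix_matrix_mult_def[of "conj_transpose (g ** u)"] D_def diag_component)
    also have "\<dots> = of_real (\<Sum>i\<in>UNIV. (norm ((g ** u) $ i $ j))\<^sup>2)"
    by (simp add: complex_norm_square mult.commute del: of_real_power)
    finally have "d $ j = (\<Sum>i\<in>UNIV. (norm ((g ** u) $ i $ j))\<^sup>2)" by (simp only: of_real_eq_iff)
    also have "\<dots> > 0" using i by (intro sum_pos2[of _ i]) auto
    finally show ?thesis .
  qed
  define h where "h = (\<chi> j. ln (d $ j) / 2)"
  define E where "E s = D (\<chi> i. exp (s * h $ i))" for s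
  have E_mult: "E s ** E t = E (s + t)" for s t
    by (simp add: E_def D_def diag_mult) (simp add: vec_eq_iff exp_add ring_distribs diag_component)
  have E_0: "E 0 = mat 1" by (simp add: E_def D_def vec_eq_iff diag_component mat_def)
  have E_2: "E 2 = D d" using pos by (simp add: E_def D_def h_def vec_eq_iff diag_component)
  have E_Herm: "conj_transpose (E s) = E s" for s
    by (simp add: E_def D_def vec_eq_iff diag_component)
  define k where "k = g ** u ** E (-1)"
  have "conj_transpose k ** k = E (-1) ** (conj_transpose (g ** u) ** (g ** u)) ** E (-1)"
    by (simp only: k_def conj_transpose_mult matrix_mul_assoc E_Herm)
  also have "\<dots> = mat 1" by (simp add: gu E_mult E_0 flip: E_2)
  finally have k: "k \<in> unitary_group" by (rule unitaryI)
  have "k ** E 1 ** conj_transpose u = g ** u ** (E (-1) ** E 1) ** conj_transpose u"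
    by (simp only: k_def matrix_mul_assoc)
  also have "\<dots> = g" by (simp add: E_mult E_0 uu flip: matrix_mul_assoc)
  finally have "g = k ** diag (\<chi> i. of_real (exp (h $ i))) ** conj_transpose u"
    by (simp add: E_def D_def)
  then show ?thesis using k u that by blast
qed

section \<open>Weight spaces\<close>

text \<open>Dedekind's independence of characters, with vector coefficients: subtracting \<open>\<phi>\<^sub>k(y)\<close> times the
  relation at \<open>x\<close> from the relation at \<open>x y\<close> eliminates the \<open>k\<close>-th term. It serves to compare
  coefficients, both of Laurent polynomials on the torus and of polynomials in one variable.\<close>
lemma (in vector_space) characters_independent:
  fixes \<phi> :: "'i \<Rightarrow> 'g::monoid_mult \<Rightarrow> 'a"
  assumes "finite I"
    and S: "1 \<in> S" "\<And>x y. x \<in> S \<Longrightarrow> y \<in> S \<Longrightarrow> x * y \<in> S"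
    and mult: "\<And>i x y. x \<in> S \<Longrightarrow> y \<in> S \<Longrightarrow> \<phi> i (x * y) = \<phi> i x * \<phi> i y"
    and one: "\<And>i. \<phi> i 1 = 1"
    and distinct: "\<And>i j. i \<noteq> j \<Longrightarrow> \<exists>x\<in>S. \<phi> i x \<noteq> \<phi> j x"
    and sum_0: "\<And>x. x \<in> S \<Longrightarrow> (\<Sum>i\<in>I. scale (\<phi> i x) (c i)) = 0"
  shows "\<forall>i\<in>I. c i = 0"
  using \<open>finite I\<close> sum_0
proof (induction I arbitrary: c rule: finite_induct)
  case (insert k I)
  have c_I: "c i = 0" if i: "i \<in> I" for i
  proof -
    have "i \<noteq> k" using i insert.hyps by blast
    then obtain y where y: "y \<in> S" "\<phi> i y \<noteq> \<phi> k y" using distinct by blast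
    have "\<forall>j\<in>I. scale (\<phi> j y - \<phi> k y) (c j) = 0"
    proof (rule insert.IH)
      fix x assume x: "x \<in> S"
      have "(\<Sum>j\<in>I. scale (\<phi> j x) (scale (\<phi> j y - \<phi> k y) (c j)))
        = (\<Sum>j\<in>insert k I. scale (\<phi> j (x * y)) (c j))
          - scale (\<phi> k y) (\<Sum>j\<in>insert k I. scale (\<phi> j x) (c j))"
        using insert.hyps x y(1)
        by (simp add: mult scale_sum_right scale_right_distrib scale_left_diff_distrib
            scale_right_diff_distrib             right_diff_distrib sum_subtractf mult.commute)
      also have "\<dots> = 0" using insert.prems x y(1) S(2) by simp
      finally show "(\<Sum>j\<in>I. scale (\<phi> j x) (scale (\<phi> j y - \<phi> k y) (c j))) = 0" .
    qed
    then show ?thesis using i y(2) by auto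
  qed
  moreover have "c k = 0"
    using insert.prems[OF S(1)] insert.hyps c_I by (simp add: one)
  ultimately show ?case by auto
qed simp

definition torus :: "(complex^'n) set"
  where "torus = {x. \<forall>i. x $ i \<noteq> 0}"

definition weight_char :: "int^'n \<Rightarrow> complex^'n \<Rightarrow> complex"
  where "weight_char \<omega> x = (\<Prod>i\<in>UNIV. (x $ i) powi (\<omega> $ i))"

lemma torus_1: "1 \<in> torus" and torus_mult: "x \<in> torus \<Longrightarrow> y \<in> torus \<Longrightarrow> x * y \<in> torus"
  by (simp_all add: torus_def)

lemma diag_torus_in_GL: "x \<in> torus \<Longrightarrow> diag x \<in> GL"
  by (simp add: torus_def diag_in_GL)

lemma weight_char_mult: "weight_char \<omega> (x * y) = weight_char \<omega> x * weight_char \<omega> y"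
  by (simp add: weight_char_def power_int_mult_distrib prod.distrib)

lemma weight_char_1: "weight_char \<omega> 1 = 1"
  by (simp add: weight_char_def)

lemma weight_char_0: "weight_char 0 x = 1"
  by (simp add: weight_char_def)

lemma weight_char_add:
  "x \<in> torus \<Longrightarrow> weight_char (\<alpha> + \<beta>) x = weight_char \<alpha> x * weight_char \<beta> x"
  by (simp add: weight_char_def torus_def power_int_add prod.distrib)

lemma weight_char_at:
  "weight_char \<omega> (\<chi> j. if j = i then s else 1) = s powi (\<omega> $ i)"
proof -
  have "weight_char \<omega> (\<chi> j. if j = i then s else 1) = (\<Prod>j\<in>UNIV. if j = i then s powi (\<omega> $ i) else 1)"
    unfolding weight_char_def by (intro prod.cong) auto
  then show ?thesis by simp
qed

lemma weight_char_axis: "weight_char (axis i 1) x = x $ i"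
proof -
  have "weight_char (axis i 1) x = (\<Prod>j\<in>UNIV. if j = i then x $ i else 1)"
    unfolding weight_char_def by (intro prod.cong) (auto simp: axis_def)
  then show ?thesis by simp
qed

lemma weight_char_inj:
  assumes "\<alpha> \<noteq> \<beta>" shows "\<exists>x\<in>torus. weight_char \<alpha> x \<noteq> weight_char \<beta> x"
proof -
  obtain i where i: "\<alpha> $ i \<noteq> \<beta> $ i" using assms by (auto simp: vec_eq_iff)
  have "(2::complex) powi a \<noteq> 2 powi b" if "a \<noteq> b" for a b
  proof
    assume "(2::complex) powi a = 2 powi b"
    then have "norm ((2::complex) powi a) = norm ((2::complex) powi b)" by simp
    then have "(2::real) powi a = 2 powi b" by (simp add: norm_power_int)
    then show False using that power_int_strict_increasing[of a b "2::real"]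
        power_int_strict_increasing[of b a "2::real"] by linarith
  qed
  then show ?thesis using i
    by (intro bexI[of _ "\<chi> j. if j = i then 2 else 1"]) (auto simp: weight_char_at torus_def)
qed

lemma weight_char_exp:
  "weight_char \<omega> (\<chi> i. of_real (exp (h $ i))) = of_real (exp (real_weight \<omega> \<bullet> h))"
proof -
  have "weight_char \<omega> (\<chi> i. of_real (exp (h $ i)))
      = (\<Prod>i\<in>UNIV. complex_of_real (exp (of_int (\<omega> $ i) * h $ i)))"
    unfolding weight_char_def
    by (intro prod.cong) (simp_all add: exp_power_int flip: of_real_power_int)
  then show ?thesis by (simp add: exp_sum real_weight_def inner_vec_def)
qed

lemma det_diag: "det (diag x) = (\<Prod>i\<in>UNIV. x $ i)"
  by (subst det_diagonal) (auto simp: diag_component)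

text \<open>On diagonal matrices \<open>det\<^sup>-\<^sup>1\<close> is itself a monomial with negative exponents, so a polynomial in the entries and
  \<open>det\<^sup>-\<^sup>1\<close> becomes a Laurent polynomial.\<close>
lemma gl_polynomial_torus:
  assumes "gl_polynomial p"
  shows "\<exists>A c. finite A \<and> (\<forall>x\<in>torus. p (diag x) = (\<Sum>\<alpha>\<in>A. c \<alpha> * weight_char \<alpha> x))"
  using assms
proof induction
  case (const a)
  show ?case by (rule exI[of _ "{0}"], rule exI[of _ "\<lambda>_. a"]) (simp add: weight_char_0)
next
  case (entry i j)
  show ?case by (rule exI[of _ "{axis i 1}"], rule exI[of _ "\<lambda>_. if i = j then 1 else 0"])
      (simp add: weight_char_axis diag_component)
next
  case inverse_det
  have "inverse (det (diag x)) = weight_char (\<chi> i. -1) x" for x :: "complex^'a"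
    by (simp add: det_diag weight_char_def power_int_minus prod_inversef[symmetric] comp_def)
  then show ?case by (intro exI[of _ "{\<chi> i. -1}"] exI[of _ "\<lambda>_. 1"]) simp
next
  case (add p q)
  then obtain A c B d where A: "finite A" "\<forall>x\<in>torus. p (diag x) = (\<Sum>\<alpha>\<in>A. c \<alpha> * weight_char \<alpha> x)"
    and B: "finite B" "\<forall>x\<in>torus. q (diag x) = (\<Sum>\<alpha>\<in>B. d \<alpha> * weight_char \<alpha> x)" by blast
  have "p (diag x) + q (diag x) = (\<Sum>\<alpha>\<in>A \<union> B.
      ((if \<alpha> \<in> A then c \<alpha> else 0) + (if \<alpha> \<in> B then d \<alpha> else 0)) * weight_char \<alpha> x)"
    if "x \<in> torus" for x
  proof -
    have "(\<Sum>\<alpha>\<in>A. c \<alpha> * weight_char \<alpha> x) = (\<Sum>\<alpha>\<in>A \<union> B. (if \<alpha> \<in> A then c \<alpha> else 0) * weight_char \<alpha> x)"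
      using A(1) B(1) by (intro sum.mono_neutral_cong_left) auto
    moreover have "(\<Sum>\<alpha>\<in>B. d \<alpha> * weight_char \<alpha> x) = (\<Sum>\<alpha>\<in>A \<union> B. (if \<alpha> \<in> B then d \<alpha> else 0) * weight_char \<alpha> x)"
      using A(1) B(1) by (intro sum.mono_neutral_cong_left) auto
    ultimately show ?thesis using A(2) B(2) that by (simp add: sum.distrib distrib_right)
  qed
  moreover have "finite (A \<union> B)" using A B by simp
  ultimately show ?case
    by (intro exI[of _ "A \<union> B"] exI[of _ "\<lambda>\<alpha>. (if \<alpha> \<in> A then c \<alpha> else 0) + (if \<alpha> \<in> B then d \<alpha> else 0)"])
       simp
next
  case (mult p q)
  then obtain A c B d where A: "finite A" "\<forall>x\<in>torus. p (diag x) = (\<Sum>\<alpha>\<in>A. c \<alpha> * weight_char \<alpha> x)"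
    and B: "finite B" "\<forall>x\<in>torus. q (diag x) = (\<Sum>\<alpha>\<in>B. d \<alpha> * weight_char \<alpha> x)" by blast
  let ?S = "(\<lambda>(\<alpha>, \<beta>). \<alpha> + \<beta>) ` (A \<times> B)"
  let ?e = "\<lambda>\<gamma>. \<Sum>(\<alpha>, \<beta>)\<in>{z \<in> A \<times> B. (\<lambda>(\<alpha>, \<beta>). \<alpha> + \<beta>) z = \<gamma>}. c \<alpha> * d \<beta>"
  have "p (diag x) * q (diag x) = (\<Sum>\<gamma>\<in>?S. ?e \<gamma> * weight_char \<gamma> x)" if x: "x \<in> torus" for x
  proof -
    have "p (diag x) * q (diag x) = (\<Sum>(\<alpha>, \<beta>)\<in>A \<times> B. (c \<alpha> * d \<beta>) * weight_char (\<alpha> + \<beta>) x)"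
      using A(2) B(2) x by (simp add: sum_product sum.cartesian_product weight_char_add mult_ac)
    also have "\<dots> = (\<Sum>\<gamma>\<in>?S. \<Sum>(\<alpha>, \<beta>)\<in>{z \<in> A \<times> B. (\<lambda>(\<alpha>, \<beta>). \<alpha> + \<beta>) z = \<gamma>}. (c \<alpha> * d \<beta>) * weight_char (\<alpha> + \<beta>) x)"
      using A(1) B(1) by (intro sum.image_gen) auto
    also have "\<dots> = (\<Sum>\<gamma>\<in>?S. ?e \<gamma> * weight_char \<gamma> x)"
      unfolding sum_distrib_right by (intro sum.cong refl) auto
    finally show ?thesis .
  qed
  moreover have "finite ?S" using A B by simp
  ultimately show ?case by (intro exI[of _ ?S] exI[of _ ?e] conjI ballI)
qed

lemma gl_polynomial_sum:
  "finite A \<Longrightarrow> (\<And>a. a \<in> A \<Longrightarrow> gl_polynomial (f a)) \<Longrightarrow> gl_polynomial (\<lambda>g. \<Sum>a\<in>A. f a g)"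
proof (induction A rule: finite_induct)
  case empty
  show ?case using gl_polynomial.const[of 0] by simp
next
  case (insert a A)
  then show ?case by (simp add: gl_polynomial.add)
qed

context hermitian_space
begin

lemma ip_add_right: "ip x (y + z) = ip x y + ip x z"
  by (metis complex_cnj_add ip_add_left ip_commute)

lemma ip_scale_right: "ip x (scaleV c y) = cnj c * ip x y"
  by (metis complex_cnj_mult ip_commute ip_scale_left)

lemma ip_0_left [simp]: "ip 0 y = 0"
  using ip_scale_left[of 0 0 y] by simp

lemma ip_0_right [simp]: "ip x 0 = 0"
  using ip_scale_right[of x 0 0] by simp

lemma ip_diff_left: "ip (x - y) z = ip x z - ip y z"
  using ip_add_left[of "x - y" y z] by simp

lemma ip_sum_left: "ip (sum f A) y = (\<Sum>a\<in>A. ip (f a) y)"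
  by (induction A rule: infinite_finite_induct) (simp_all add: ip_add_left)

lemma ip_sum_right: "ip x (sum f A) = (\<Sum>a\<in>A. ip x (f a))"
  by (induction A rule: infinite_finite_induct) (simp_all add: ip_add_right)

lemma ip_self_eq_0: "ip x x = 0 \<longleftrightarrow> x = 0"
  using ip_pos[of x] by (cases "x = 0") auto

lemma Re_ip_self_nonneg: "Re (ip x x) \<ge> 0"
  using ip_pos[of x] by (cases "x = 0") auto

lemma ipnorm_power2: "(ipnorm ip x)\<^sup>2 = Re (ip x x)"
  by (simp add: ipnorm_def Re_ip_self_nonneg)

lemma ipnorm_nonneg: "ipnorm ip x \<ge> 0"
  by (simp add: ipnorm_def Re_ip_self_nonneg)

lemma ipnorm_pos: "x \<noteq> 0 \<Longrightarrow> ipnorm ip x > 0"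
  by (simp add: ipnorm_def ip_pos)

end

context unitary_rational_rep
begin

lemma rep_add: "g \<in> GL \<Longrightarrow> \<pi> g (x + y) = \<pi> g x + \<pi> g y"
  and rep_scale: "g \<in> GL \<Longrightarrow> \<pi> g (scaleV c x) = scaleV c (\<pi> g x)"
  using rep_linear[of g] by (simp_all add: Vector_Spaces.linear_iff)

lemma rep_0: "g \<in> GL \<Longrightarrow> \<pi> g 0 = 0"
  using rep_scale[of g 0 0] by simp

lemma rep_diff: "g \<in> GL \<Longrightarrow> \<pi> g (x - y) = \<pi> g x - \<pi> g y"
  using rep_add[of g "x - y" y] by simp

lemma rep_sum: "g \<in> GL \<Longrightarrow> \<pi> g (sum f A) = (\<Sum>a\<in>A. \<pi> g (f a))"
  by (induction A rule: infinite_finite_induct) (simp_all add: rep_add rep_0)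

lemma rep_mult_apply: "g \<in> GL \<Longrightarrow> h \<in> GL \<Longrightarrow> \<pi> (g ** h) w = \<pi> g (\<pi> h w)"
  by (simp add: rep_mult)

lemma rep_one: "\<pi> (mat 1) w = w"
proof -
  have "\<pi> (mat 1) (\<pi> (mat 1) w) = \<pi> (mat 1) w"
    using rep_mult_apply[of "mat 1" "mat 1" w] by simp
  then show ?thesis using rep_bij[of "mat 1"] by (simp add: bij_def inj_eq)
qed

text \<open>Rationality is given for matrix entries in the basis; by linearity the coordinates of every
  orbit map are polynomial too.\<close>
lemma rep_orbit_polynomial:
  obtains P where "\<And>b. b \<in> Basis \<Longrightarrow> gl_polynomial (P b)"
    "\<And>g. g \<in> GL \<Longrightarrow> \<pi> g w = (\<Sum>b\<in>Basis. scaleV (P b g) b)"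
proof -
  define r where "r = representation Basis w"
  obtain p where p: "\<And>b b'. b \<in> Basis \<Longrightarrow> b' \<in> Basis \<Longrightarrow> gl_polynomial (p b b')"
      "\<And>b b' g. b \<in> Basis \<Longrightarrow> b' \<in> Basis \<Longrightarrow> g \<in> GL \<Longrightarrow> representation Basis (\<pi> g b) b' = p b b' g"
    using rep_rational by metis
  have expand: "(\<Sum>b\<in>Basis. scaleV (representation Basis x b) b) = x" for x
    by (rule sum_representation_eq) (simp_all add: independent_Basis span_Basis finite_Basis)
  show ?thesis
  proof
    fix b assume b: "b \<in> Basis"
    show "gl_polynomial (\<lambda>g. \<Sum>a\<in>Basis. r a * p a b g)"
      using b p(1) by (intro gl_polynomial_sum finite_Basis gl_polynomial.mult gl_polynomial.const)
  next
    fix g :: "complex^'n^'n" assume g: "g \<in> GL"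
    have "\<pi> g w = (\<Sum>a\<in>Basis. scaleV (r a) (\<pi> g a))"
      using g by (subst expand[of w, symmetric]) (simp only: rep_sum rep_scale r_def)
    also have "\<dots> = (\<Sum>a\<in>Basis. \<Sum>b\<in>Basis. scaleV (r a * p a b g) b)"
    proof (rule sum.cong[OF refl])
      fix a assume a: "a \<in> Basis"
      have "scaleV (r a) (\<pi> g a) = (\<Sum>b\<in>Basis. scaleV (r a * representation Basis (\<pi> g a) b) b)"
        by (subst expand[of "\<pi> g a", symmetric]) (simp only: scale_sum_right scale_scale)
      then show "scaleV (r a) (\<pi> g a) = (\<Sum>b\<in>Basis. scaleV (r a * p a b g) b)"
        using p(2) a g by simp
    qed
    also have "\<dots> = (\<Sum>b\<in>Basis. scaleV (\<Sum>a\<in>Basis. r a * p a b g) b)"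
      by (subst sum.swap) (simp add: scale_sum_left)
    finally show "\<pi> g w = (\<Sum>b\<in>Basis. scaleV (\<Sum>a\<in>Basis. r a * p a b g) b)" .
  qed
qed

lemma weight_space_iff:
  "w \<in> weight_space scaleV \<pi> \<omega> \<longleftrightarrow> (\<forall>x\<in>torus. \<pi> (diag x) w = scaleV (weight_char \<omega> x) w)"
  by (auto simp: weight_space_def torus_def weight_char_def)

lemma weight_spaceD:
  "w \<in> weight_space scaleV \<pi> \<omega> \<Longrightarrow> x \<in> torus \<Longrightarrow> \<pi> (diag x) w = scaleV (weight_char \<omega> x) w"
  by (simp add: weight_space_iff)

text \<open>Expand \<open>\<pi>(diag x) w\<close> as a Laurent polynomial in \<open>x\<close> with coefficients \<open>d \<alpha>\<close> in \<open>V\<close>. Since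
  \<open>\<pi>(diag y) \<pi>(diag x) = \<pi>(diag (y x))\<close>, comparing coefficients shows that \<open>d \<alpha>\<close> is a weight vector, and
  \<open>x = 1\<close> gives back \<open>w\<close>.\<close>
lemma weight_vectors_span:
  shows "\<exists>A c. finite A \<and> (\<forall>\<alpha>. c \<alpha> \<in> weight_space scaleV \<pi> \<alpha>) \<and> w = (\<Sum>\<alpha>\<in>A. c \<alpha>)"
proof -
  obtain P where P: "\<And>b. b \<in> Basis \<Longrightarrow> gl_polynomial (P b)"
    "\<And>g. g \<in> GL \<Longrightarrow> \<pi> g w = (\<Sum>b\<in>Basis. scaleV (P b g) b)"
    using rep_orbit_polynomial[of w] by blast
  have "\<forall>b\<in>Basis. \<exists>A c. finite A \<and> (\<forall>x\<in>torus. P b (diag x) = (\<Sum>\<alpha>\<in>A. c \<alpha> * weight_char \<alpha> x))"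
    using gl_polynomial_torus P(1) by blast
  then obtain A c where A: "\<And>b. b \<in> Basis \<Longrightarrow> finite (A b)"
     and c: "\<And>b x. b \<in> Basis \<Longrightarrow> x \<in> torus \<Longrightarrow> P b (diag x) = (\<Sum>\<alpha>\<in>A b. c b \<alpha> * weight_char \<alpha> x)"
    by metis
  define B where "B = (\<Union>b\<in>Basis. A b)"
  define d where "d \<alpha> = (\<Sum>b\<in>Basis. scaleV (if \<alpha> \<in> A b then c b \<alpha> else 0) b)" for \<alpha>
  have B: "finite B" using A finite_Basis by (auto simp: B_def)
  \<comment> \<open>The exponents of the different coordinates are collected in the common finite set \<open>B\<close>.\<close>
  have expand: "\<pi> (diag x) w = (\<Sum>\<alpha>\<in>B. scaleV (weight_char \<alpha> x) (d \<alpha>))" if x: "x \<in> torus" for x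
  proof -
    have "P b (diag x) = (\<Sum>\<alpha>\<in>B. weight_char \<alpha> x * (if \<alpha> \<in> A b then c b \<alpha> else 0))" if b: "b \<in> Basis" for b
      unfolding c[OF b x] using B b by (intro sum.mono_neutral_cong_left) (auto simp: B_def)
    then have "\<pi> (diag x) w = (\<Sum>b\<in>Basis. \<Sum>\<alpha>\<in>B. scaleV (weight_char \<alpha> x * (if \<alpha> \<in> A b then c b \<alpha> else 0)) b)"
      using x by (simp add: P(2) diag_torus_in_GL scale_sum_left)
    also have "\<dots> = (\<Sum>\<alpha>\<in>B. scaleV (weight_char \<alpha> x) (d \<alpha>))"
      unfolding d_def by (subst sum.swap) (simp only: scale_sum_right scale_scale)
    finally show ?thesis .
  qed
  have wt: "d \<alpha> \<in> weight_space scaleV \<pi> \<alpha>" if "\<alpha> \<in> B" for \<alpha>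
  proof -
    have "\<pi> (diag y) (d \<alpha>) = scaleV (weight_char \<alpha> y) (d \<alpha>)" if y: "y \<in> torus" for y
    proof -
      have "\<forall>\<alpha>\<in>B. \<pi> (diag y) (d \<alpha>) - scaleV (weight_char \<alpha> y) (d \<alpha>) = 0"
      proof (rule characters_independent[of B torus weight_char])
        fix x :: "complex^'n" assume x: "x \<in> torus"
        have yx: "y * x \<in> torus" and GL: "diag x \<in> GL" "diag y \<in> GL"
          using x y by (simp_all add: torus_mult diag_torus_in_GL)
        have "(\<Sum>\<alpha>\<in>B. scaleV (weight_char \<alpha> x) (\<pi> (diag y) (d \<alpha>)))
            = \<pi> (diag y) (\<pi> (diag x) w)"
          using x by (simp add: expand rep_sum[OF GL(2)] rep_scale[OF GL(2)])
        also have "\<dots> = \<pi> (diag (y * x)) w" using GL by (simp flip: diag_mult rep_mult_apply)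
        also have "\<dots> = (\<Sum>\<alpha>\<in>B. scaleV (weight_char \<alpha> x) (scaleV (weight_char \<alpha> y) (d \<alpha>)))"
          using yx by (simp add: expand weight_char_mult mult.commute)
        finally show "(\<Sum>\<alpha>\<in>B. scaleV (weight_char \<alpha> x)
           (\<pi> (diag y) (d \<alpha>) - scaleV (weight_char \<alpha> y) (d \<alpha>))) = 0"
          by (simp add: scale_right_diff_distrib sum_subtractf)
      qed (use B in \<open>simp_all add: torus_1 torus_mult weight_char_mult weight_char_1 weight_char_inj\<close>)
      then show ?thesis using \<open>\<alpha> \<in> B\<close> by simp
    qed
    then show ?thesis by (simp add: weight_space_iff)
  qed
  have zero: "0 \<in> weight_space scaleV \<pi> \<alpha>" for \<alpha>
    by (simp add: weight_space_iff rep_0 diag_torus_in_GL)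
  have "w = (\<Sum>\<alpha>\<in>B. if \<alpha> \<in> B then d \<alpha> else 0)"
    using expand[OF torus_1] by (simp add: rep_one weight_char_1)
  moreover have "(if \<alpha> \<in> B then d \<alpha> else 0) \<in> weight_space scaleV \<pi> \<alpha>" for \<alpha>
    using wt zero by simp
  ultimately show ?thesis using B
    by (intro exI[of _ B] exI[of _ "\<lambda>\<alpha>. if \<alpha> \<in> B then d \<alpha> else 0"] conjI allI)
qed

lemma diag_unitary: "(\<And>i. cmod (x $ i) = 1) \<Longrightarrow> diag x \<in> unitary_group"
proof (rule unitaryI)
  assume "\<And>i. cmod (x $ i) = 1"
  then have "cnj (x $ i) * x $ i = 1" for i
    by (metis complex_norm_square mult.commute of_real_1 power_one)
  then show "conj_transpose (diag x) ** diag x = mat 1"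
    by (simp add: vec_eq_iff diag_component mat_def)
qed

text \<open>A unitary diagonal matrix multiplies \<open>ip v w\<close> by the ratio of the two
  characters and also preserves it; the matrix is chosen so that this ratio is \<open>-1\<close>.\<close>
lemma weight_spaces_orthogonal:
  assumes "v \<in> weight_space scaleV \<pi> \<alpha>" "w \<in> weight_space scaleV \<pi> \<beta>" "\<alpha> \<noteq> \<beta>"
  shows "ip v w = 0"
proof -
  obtain i where i: "\<alpha> $ i \<noteq> \<beta> $ i" using assms by (auto simp: vec_eq_iff)
  define k where "k = \<alpha> $ i - \<beta> $ i"
  \<comment> \<open>\<open>s\<^sup>k = -1\<close>\<close>
  define s where "s = cis (pi / of_int k)"
  define x :: "complex^'n" where "x = (\<chi> j. if j = i then s else 1)"
  have s: "s \<noteq> 0" "cnj s = inverse s" by (simp_all add: s_def cis_cnj)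
  have x: "x \<in> torus" and u: "diag x \<in> unitary_group"
    using s(1) by (auto simp: x_def torus_def s_def intro!: diag_unitary)
  have "ip v w = ip (\<pi> (diag x) v) (\<pi> (diag x) w)" using u by (simp add: rep_unitary)
  also have "\<dots> = s powi (\<alpha> $ i) * cnj (s powi (\<beta> $ i)) * ip v w"
    using assms(1,2) x
    by (simp add: weight_spaceD ip_scale_left ip_scale_right) (simp add: x_def weight_char_at)
  also have "s powi (\<alpha> $ i) * cnj (s powi (\<beta> $ i)) = s powi k"
    using s by (simp add: complex_cnj_power_int power_int_inverse power_int_diff k_def divide_inverse)
  also have "s powi k = -1"
    using i by (simp add: s_def cis_power_int k_def)
  finally show ?thesis by simp
qed

text \<open>A weight that occurs in no basis vector would have its weight vectors orthogonal to the
  whole basis.\<close>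
lemma finite_weights: "finite (weights scaleV \<pi>)"
proof -
  obtain A c where A: "\<And>b. finite (A b)" and c: "\<And>b \<alpha>. c b \<alpha> \<in> weight_space scaleV \<pi> \<alpha>"
    and sum: "\<And>b. b = (\<Sum>\<alpha>\<in>A b. c b \<alpha>)"
    using weight_vectors_span by metis
  have "weights scaleV \<pi> \<subseteq> (\<Union>b\<in>Basis. A b)"
  proof (rule subsetI, rule ccontr)
    fix \<omega> assume "\<omega> \<in> weights scaleV \<pi>" and \<omega>: "\<omega> \<notin> (\<Union>b\<in>Basis. A b)"
    then obtain w where w: "w \<in> weight_space scaleV \<pi> \<omega>" "w \<noteq> 0" by (auto simp: weights_def)
    have "ip b w = 0" if "b \<in> Basis" for b
    proof -
      have "ip b w = (\<Sum>\<alpha>\<in>A b. ip (c b \<alpha>) w)" by (subst sum) (rule ip_sum_left)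
      also have "\<dots> = 0"
        using \<omega> that by (intro sum.neutral ballI weight_spaces_orthogonal[OF c w(1)]) auto
      finally show ?thesis .
    qed
    moreover have "w = (\<Sum>b\<in>Basis. scaleV (representation Basis w b) b)"
      by (rule sum_representation_eq[symmetric]) (simp_all add: independent_Basis span_Basis finite_Basis)
    ultimately have "ip w w = 0" by (metis (no_types, lifting) ip_scale_left ip_sum_left mult_zero_right sum.neutral)
    then show False using w(2) by (simp add: ip_self_eq_0)
  qed
  then show ?thesis by (rule finite_subset) (use A finite_Basis in auto)
qed

lemma weight_decomposition:
  obtains c where "\<And>\<omega>. c \<omega> \<in> weight_space scaleV \<pi> \<omega>" "w = (\<Sum>\<omega>\<in>weights scaleV \<pi>. c \<omega>)"
proof -
  obtain A c where A: "finite A" and c: "\<And>\<alpha>. c \<alpha> \<in> weight_space scaleV \<pi> \<alpha>" and w: "w = (\<Sum>\<alpha>\<in>A. c \<alpha>)"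
    using weight_vectors_span by blast
  define d where "d \<alpha> = (if \<alpha> \<in> A then c \<alpha> else 0)" for \<alpha>
  have d: "d \<alpha> \<in> weight_space scaleV \<pi> \<alpha>" for \<alpha>
    using c by (auto simp: d_def weight_space_iff rep_0 diag_torus_in_GL)
  have "w = (\<Sum>\<omega>\<in>weights scaleV \<pi>. d \<omega>)"
  proof -
    have "w = (\<Sum>\<alpha>\<in>A \<union> weights scaleV \<pi>. d \<alpha>)"
      unfolding w using A finite_weights by (intro sum.mono_neutral_cong_left) (auto simp: d_def)
    also have "\<dots> = (\<Sum>\<omega>\<in>weights scaleV \<pi>. d \<omega>)"
      using A finite_weights d by (intro sum.mono_neutral_right) (auto simp: weights_def)
    finally show ?thesis .
  qed
  then show ?thesis using d that by blast
qed

text \<open>Pythagoras for the orthogonal decomposition into weight vectors.\<close>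
lemma norm_torus_orbit:
  assumes c: "\<And>\<omega>. c \<omega> \<in> weight_space scaleV \<pi> \<omega>" and w: "w = (\<Sum>\<omega>\<in>weights scaleV \<pi>. c \<omega>)"
  shows "(ipnorm ip (\<pi> (diag (\<chi> i. of_real (exp (h $ i)))) w))\<^sup>2 =
    (\<Sum>\<omega>\<in>weights scaleV \<pi>. Re (ip (c \<omega>) (c \<omega>)) * exp (2 * (real_weight \<omega> \<bullet> h)))"
proof -
  define x where "x = (\<chi> i. complex_of_real (exp (h $ i)))"
  have x: "x \<in> torus" by (simp add: x_def torus_def)
  define e where "e \<omega> = exp (real_weight \<omega> \<bullet> h)" for \<omega> :: "int^'n"
  have "\<pi> (diag x) (c \<omega>) = scaleV (of_real (e \<omega>)) (c \<omega>)" for \<omega>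
    using weight_spaceD[OF c x] by (simp only: x_def e_def weight_char_exp)
  then have "\<pi> (diag x) w = (\<Sum>\<omega>\<in>weights scaleV \<pi>. scaleV (of_real (e \<omega>)) (c \<omega>))"
    using x by (simp add: w rep_sum diag_torus_in_GL)
  then have "ip (\<pi> (diag x) w) (\<pi> (diag x) w)
    = (\<Sum>\<alpha>\<in>weights scaleV \<pi>. \<Sum>\<beta>\<in>weights scaleV \<pi>. of_real (e \<alpha>) * (of_real (e \<beta>) * ip (c \<beta>) (c \<alpha>)))"
    by (simp add: ip_sum_left ip_sum_right ip_scale_left ip_scale_right sum_distrib_left)
  also have "\<dots> = (\<Sum>\<alpha>\<in>weights scaleV \<pi>. \<Sum>\<beta>\<in>weights scaleV \<pi>.
      if \<beta> = \<alpha> then of_real (e \<alpha>) * (of_real (e \<alpha>) * ip (c \<alpha>) (c \<alpha>)) else 0)"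
    by (intro sum.cong refl) (auto simp: weight_spaces_orthogonal[OF c c])
  also have "\<dots> = (\<Sum>\<alpha>\<in>weights scaleV \<pi>. of_real (e \<alpha>) * (of_real (e \<alpha>) * ip (c \<alpha>) (c \<alpha>)))"
    using finite_weights by simp
  finally have "(ipnorm ip (\<pi> (diag x) w))\<^sup>2 = (\<Sum>\<alpha>\<in>weights scaleV \<pi>. e \<alpha> * (e \<alpha> * Re (ip (c \<alpha>) (c \<alpha>))))"
    by (simp add: ipnorm_power2)
  then show ?thesis
    by (simp add: x_def e_def mult_exp_exp mult.assoc[symmetric] mult.commute)
qed

end

section \<open>The moment map\<close>

lemma differentiable_prod:
  fixes f :: "'i \<Rightarrow> 'a::real_normed_vector \<Rightarrow> 'b::real_normed_field"
  shows "(\<And>i. i \<in> I \<Longrightarrow> f i differentiable (at x within S))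
    \<Longrightarrow> (\<lambda>x. \<Prod>i\<in>I. f i x) differentiable (at x within S)"
  by (induction I rule: infinite_finite_induct) auto

lemma entry_differentiable: "(\<lambda>g. (g :: complex^'n^'n) $ i $ j) differentiable F"
  using bounded_linear_compose[OF bounded_linear_vec_nth bounded_linear_vec_nth]
  by (rule bounded_linear_imp_differentiable)

lemma gl_polynomial_differentiable:
  fixes g :: "complex^'n^'n"
  assumes "gl_polynomial p" and g: "g \<in> GL"
  shows "p differentiable (at g)"
  using assms(1)
proof induction
  case inverse_det
  have "(\<lambda>g :: complex^'n^'n. det g) differentiable (at g)"
    unfolding det_def
    by (intro differentiable_sum finite_permutations ballI differentiable_mult differentiable_const
        differentiable_prod entry_differentiable finite)
  moreover have "det g \<noteq> 0" using g by (simp add: GL_def invertible_det_nz)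
  ultimately show ?case by (rule differentiable_inverse)
qed (auto intro: entry_differentiable)

text \<open>The derivative of \<open>mexp (t H)\<close> at \<open>0\<close>; spectral form avoids differentiating the exponential series.\<close>
lemma eigen_matrix_exp_curve:
  fixes u :: "complex^'n^'n"
  assumes u: "u \<in> unitary_group"
  shows "((\<lambda>t. eigen_matrix u (\<chi> i. exp (t * d $ i))) has_vector_derivative eigen_matrix u d) (at 0)"
proof -
  define E :: "'n \<Rightarrow> complex^'n^'n" where "E k = (\<chi> i j. u $ i $ k * cnj (u $ j $ k))" for k
  have E: "eigen_matrix u x = (\<Sum>k\<in>UNIV. x $ k *\<^sub>R E k)" for x
    by (simp add: vec_eq_iff eigen_matrix_component E_def)
  show ?thesis unfolding E
    by (auto intro!: derivative_eq_intros)
qed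

lemma eigen_matrix_exp_in_GL:
  assumes u: "u \<in> unitary_group" shows "eigen_matrix u (\<chi> i. exp (h $ i)) \<in> GL"
  unfolding eigen_matrix_def using u
  by (intro GL_mult unitary_in_GL unitary_conj_transpose diag_in_GL) auto

lemma inner_Herm:
  assumes "A \<in> Herm" "B \<in> Herm" shows "trace (A ** B) = complex_of_real (A \<bullet> B)"
proof (rule complex_eqI)
  have AB: "conj_transpose A = A" "conj_transpose B = B" using assms by (auto simp: Herm_def)
  then show "Re (trace (A ** B)) = Re (complex_of_real (A \<bullet> B))" by (simp add: inner_complex_matrix)
  have "cnj (trace (A ** B)) = trace (conj_transpose (A ** B))"
    by (simp add: trace_def)
  also have "\<dots> = trace (A ** B)" unfolding conj_transpose_mult AB by (rule trace_mul_sym)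
  finally show "Im (trace (A ** B)) = Im (complex_of_real (A \<bullet> B))"
    by (simp add: complex_eq_iff)
qed

lemma inner_conj_transpose: "conj_transpose A \<bullet> B = A \<bullet> conj_transpose B"
proof -
  have "conj_transpose A \<bullet> B = Re (cnj (trace (A ** B)))" by (simp add: inner_complex_matrix)
  also have "cnj (trace (A ** B)) = trace (conj_transpose (A ** B))" by (simp add: trace_def)
  also have "\<dots> = trace (conj_transpose A ** conj_transpose B)"
    unfolding conj_transpose_mult by (rule trace_mul_sym)
  finally show ?thesis by (simp add: inner_complex_matrix)
qed

text \<open>Riesz representation on the space of all complex matrices, followed by symmetrization, which does not change
  the values on Hermitian matrices.\<close>
lemma linear_functional_Herm:
  fixes L :: "complex^'n^'n \<Rightarrow> real"
  assumes "linear L"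
  obtains M where "M \<in> Herm" "\<And>H. H \<in> Herm \<Longrightarrow> M \<bullet> H = L H"
proof -
  define A where "A = (\<Sum>b\<in>Basis. L b *\<^sub>R b)"
  have A: "A \<bullet> H = L H" for H
  proof -
    have "L H = L (\<Sum>b\<in>Basis. (H \<bullet> b) *\<^sub>R b)" by (simp add: euclidean_representation)
    then show ?thesis
      using assms by (simp add: A_def linear_sum linear_scale inner_sum_left inner_sum_right inner_commute mult.commute)
  qed
  define M where "M = (1/2) *\<^sub>R (A + conj_transpose A)"
  have "M \<in> Herm" by (simp add: M_def Herm_def vec_eq_iff add.commute)
  moreover have "M \<bullet> H = L H" if "H \<in> Herm" for H
    using that by (simp add: M_def inner_add_left inner_conj_transpose A Herm_def)
  ultimately show ?thesis using that by blast
qed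

lemma half_ln_derivative:
  fixes f :: "real \<Rightarrow> real"
  assumes "(f has_real_derivative d) (at x)" "f x > 0"
  shows "((\<lambda>t. ln (f t) / 2) has_real_derivative d / (2 * f x)) (at x)"
  using assms by (auto intro!: derivative_eq_intros)

context unitary_rational_rep
begin

lemma ipnorm_unitary: "u \<in> unitary_group \<Longrightarrow> ipnorm ip (\<pi> u x) = ipnorm ip x"
  by (simp add: ipnorm_def rep_unitary)

text \<open>The derivative depends linearly on \<open>H\<close> by the chain rule, because the squared
  norm along the orbit is the restriction to \<^const>\<open>GL\<close> of a function \<open>Q\<close> that is differentiable at the identity.\<close>
lemma norm_orbit_derivative:
  obtains D where "linear D"
    "\<And>H. H \<in> Herm \<Longrightarrow> ((\<lambda>t. (ipnorm ip (\<pi> (mexp (t *\<^sub>R H)) v))\<^sup>2) has_real_derivative D H) (at 0)"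
proof -
  obtain P where P: "\<And>b. b \<in> Basis \<Longrightarrow> gl_polynomial (P b)"
    "\<And>g. g \<in> GL \<Longrightarrow> \<pi> g v = (\<Sum>b\<in>Basis. scaleV (P b g) b)"
    using rep_orbit_polynomial[of v] by blast
  define Q where "Q g = Re (\<Sum>b\<in>Basis. \<Sum>b'\<in>Basis. P b g * cnj (P b' g) * ip b b')" for g
  have Q: "(ipnorm ip (\<pi> g v))\<^sup>2 = Q g" if "g \<in> GL" for g
    unfolding ipnorm_power2 Q_def P(2)[OF that]
    by (subst sum.swap) (simp add: ip_sum_left ip_sum_right ip_scale_left ip_scale_right mult_ac sum_distrib_left)
  have cnj_diff: "(\<lambda>g. cnj (f g)) differentiable F" if "f differentiable F" for f :: "complex^'n^'n \<Rightarrow> complex" and F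
    using that bounded_linear.has_derivative[OF bounded_linear_cnj] unfolding differentiable_def by blast
  have Re_diff: "(\<lambda>g. Re (f g)) differentiable F" if "f differentiable F" for f :: "complex^'n^'n \<Rightarrow> complex" and F
    using that bounded_linear.has_derivative[OF bounded_linear_Re] unfolding differentiable_def by blast
  have "Q differentiable (at (mat 1))"
    unfolding Q_def using finite_Basis
    by (intro Re_diff differentiable_sum ballI differentiable_mult cnj_diff differentiable_const
        gl_polynomial_differentiable P mat_1_in_GL)
  then obtain D where D: "(Q has_derivative D) (at (mat 1))" by (auto simp: differentiable_def)
  show ?thesis
  proof
    show "linear D" using has_derivative_bounded_linear[OF D] by (rule bounded_linear.linear)
    fix H :: "complex^'n^'n" assume "H \<in> Herm"
    then obtain u d where u: "u \<in> unitary_group" and H: "H = eigen_matrix u d" by (rule Herm_diagonalizable)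
    let ?\<gamma> = "\<lambda>t. eigen_matrix u (\<chi> i. exp (t * d $ i))"
    have "(\<chi> i. exp (0 * d $ i)) = (1 :: real^'n)" by (simp add: vec_eq_iff)
    then have 0: "?\<gamma> 0 = mat 1" by (simp only: eigen_matrix_1[OF u])
    have GL: "?\<gamma> t \<in> GL" for t using eigen_matrix_exp_in_GL[OF u, of "t *\<^sub>R d"] by simp
    have "(?\<gamma> has_derivative (\<lambda>t. t *\<^sub>R H)) (at 0)"
      using eigen_matrix_exp_curve[OF u, of d] by (simp add: has_vector_derivative_def H)
    from has_derivative_compose[OF this, of Q D] have "((\<lambda>t. Q (?\<gamma> t)) has_derivative (\<lambda>t. D (t *\<^sub>R H))) (at 0)"
      using D by (simp only: 0)
    moreover have "D (t *\<^sub>R H) = D H * t" for t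
      using linear_scale[OF \<open>linear D\<close>] by (simp add: mult.commute)
    ultimately show "((\<lambda>t. (ipnorm ip (\<pi> (mexp (t *\<^sub>R H)) v))\<^sup>2) has_real_derivative D H) (at 0)"
      by (simp add: has_field_derivative_def H mexp_scaleR_eigen_matrix[OF u] Q[OF GL] mult_commute_abs)
  qed
qed

lemma mexp_0: "mexp (0 *\<^sub>R H) = mat 1" if "H \<in> Herm" for H :: "complex^'n^'n"
proof -
  obtain u d where u: "u \<in> unitary_group" and H: "H = eigen_matrix u d" using Herm_diagonalizable \<open>H \<in> Herm\<close> by blast
  have "(\<chi> i. exp (0 * d $ i)) = (1 :: real^'n)" by (simp add: vec_eq_iff)
  then show ?thesis unfolding H mexp_scaleR_eigen_matrix[OF u] by (simp only: eigen_matrix_1[OF u])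
qed

text \<open>The Hermitian matrix representing the derivative is unique because the difference of two
  candidates is Hermitian and orthogonal to itself; so the description in the definition is
  proper and the moment map is the gradient of the logarithm of the norm.\<close>
lemma moment_map:
  assumes "v \<noteq> 0"
  shows "moment_map ip \<pi> v \<in> Herm"
    and "H \<in> Herm \<Longrightarrow> ((\<lambda>t. ln (ipnorm ip (\<pi> (mexp (t *\<^sub>R H)) v)))
      has_real_derivative (moment_map ip \<pi> v \<bullet> H)) (at 0)"
proof -
  obtain D where D: "linear D"
    "\<And>H. H \<in> Herm \<Longrightarrow> ((\<lambda>t. (ipnorm ip (\<pi> (mexp (t *\<^sub>R H)) v))\<^sup>2) has_real_derivative D H) (at 0)"
    using norm_orbit_derivative[of v] by blast
  define L where "L H = D H / (2 * (ipnorm ip v)\<^sup>2)" for H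
  have "linear L" using D(1) by (simp add: L_def linear_iff add_divide_distrib)
  then obtain M where M: "M \<in> Herm" "\<And>H. H \<in> Herm \<Longrightarrow> M \<bullet> H = L H"
    using linear_functional_Herm by blast
  have ln_norm: "ln (ipnorm ip x) = ln ((ipnorm ip x)\<^sup>2) / 2" for x
    using ipnorm_nonneg[of x] by (cases "ipnorm ip x = 0") (simp_all add: ln_realpow)
  have deriv: "((\<lambda>t. ln (ipnorm ip (\<pi> (mexp (t *\<^sub>R H)) v))) has_real_derivative (M \<bullet> H)) (at 0)"
    if H: "H \<in> Herm" for H
    unfolding ln_norm
    using half_ln_derivative[OF D(2)[OF H]] ipnorm_pos[OF assms] M(2)[OF H]
    unfolding mexp_0[OF H] rep_one L_def by simp
  have "moment_map ip \<pi> v = M"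
    unfolding moment_map_def
  proof (rule the_equality)
    show "M \<in> Herm \<and> (\<forall>H\<in>Herm. \<exists>d. trace (M ** H) = complex_of_real d \<and>
        ((\<lambda>t. ln (ipnorm ip (\<pi> (mexp (t *\<^sub>R H)) v))) has_real_derivative d) (at 0))"
      using M(1) deriv inner_Herm by blast
  next
    fix M' assume M': "M' \<in> Herm \<and> (\<forall>H\<in>Herm. \<exists>d. trace (M' ** H) = complex_of_real d \<and>
        ((\<lambda>t. ln (ipnorm ip (\<pi> (mexp (t *\<^sub>R H)) v))) has_real_derivative d) (at 0))"
    have eq: "M' \<bullet> H = M \<bullet> H" if H: "H \<in> Herm" for H
    proof -
      obtain d where "trace (M' ** H) = complex_of_real d"
        "((\<lambda>t. ln (ipnorm ip (\<pi> (mexp (t *\<^sub>R H)) v))) has_real_derivative d) (at 0)"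
        using M' H by blast
      then show ?thesis
        using DERIV_unique[OF deriv[OF H]] inner_Herm[of M' H] M' H by simp
    qed
    have "M' - M \<in> Herm" using M' M(1) by (simp add: Herm_def vec_eq_iff)
    from eq[OF this] have "(M' - M) \<bullet> (M' - M) = 0" by (simp add: inner_diff_left)
    then show "M' = M" by simp
  qed
  then show "moment_map ip \<pi> v \<in> Herm" 
    and "H \<in> Herm \<Longrightarrow> ((\<lambda>t. ln (ipnorm ip (\<pi> (mexp (t *\<^sub>R H)) v)))
      has_real_derivative (moment_map ip \<pi> v \<bullet> H)) (at 0)"
    using M(1) deriv by simp_all
qed

text \<open>The squared norm anywhere on the orbit is a sum of exponentials. Here \<open>c\<close> is the weight
  decomposition of \<open>\<pi>(u\<^sup>*) v\<close>, and the left unitary factor acts isometrically.\<close>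
lemma norm_orbit:
  assumes k: "k \<in> unitary_group" and u: "u \<in> unitary_group"
    and c: "\<And>\<omega>. c \<omega> \<in> weight_space scaleV \<pi> \<omega>"
    and v: "\<pi> (conj_transpose u) v = (\<Sum>\<omega>\<in>weights scaleV \<pi>. c \<omega>)"
  shows "(ipnorm ip (\<pi> (k ** diag (\<chi> i. of_real (exp (h $ i))) ** conj_transpose u) v))\<^sup>2 =
    (\<Sum>\<omega>\<in>weights scaleV \<pi>. Re (ip (c \<omega>) (c \<omega>)) * exp (2 * (real_weight \<omega> \<bullet> h)))"
proof -
  let ?d = "diag (\<chi> i. complex_of_real (exp (h $ i)))"
  have d: "?d \<in> GL" by (rule diag_in_GL) simp
  have "\<pi> (k ** ?d ** conj_transpose u) v = \<pi> k (\<pi> ?d (\<pi> (conj_transpose u) v))"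
    using k u d by (simp add: rep_mult_apply GL_mult unitary_in_GL unitary_conj_transpose)
  then show ?thesis
    using norm_torus_orbit[OF c v] k by (simp add: ipnorm_unitary)
qed

lemma sum_weight_components:
  assumes u: "u \<in> unitary_group"
    and c: "\<And>\<omega>. c \<omega> \<in> weight_space scaleV \<pi> \<omega>"
    and v: "\<pi> (conj_transpose u) v = (\<Sum>\<omega>\<in>weights scaleV \<pi>. c \<omega>)"
  shows "(\<Sum>\<omega>\<in>weights scaleV \<pi>. Re (ip (c \<omega>) (c \<omega>))) = (ipnorm ip v)\<^sup>2"
proof -
  have "(\<chi> i. complex_of_real (exp ((0::real^'n) $ i))) = 1" by (simp add: vec_eq_iff)
  moreover have "u ** conj_transpose u = mat 1" using u by (simp add: unitary_group_def)
  ultimately show ?thesis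
    using norm_orbit[OF u u c v, of 0] by (simp add: rep_one)
qed

text \<open>The mean weight of \<open>\<pi>(u\<^sup>*) v\<close> is the diagonal of the moment map in the
  eigenbasis \<open>u\<close>: differentiate the formula for the norm along \<open>exp (t h)\<close>.\<close>
lemma moment_map_weights:
  assumes "v \<noteq> 0" and u: "u \<in> unitary_group"
    and c: "\<And>\<omega>. c \<omega> \<in> weight_space scaleV \<pi> \<omega>"
    and v: "\<pi> (conj_transpose u) v = (\<Sum>\<omega>\<in>weights scaleV \<pi>. c \<omega>)"
  shows "moment_map ip \<pi> v \<bullet> eigen_matrix u h =
    (\<Sum>\<omega>\<in>weights scaleV \<pi>. Re (ip (c \<omega>) (c \<omega>)) * (real_weight \<omega> \<bullet> h)) / (ipnorm ip v)\<^sup>2"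
proof -
  let ?p = "\<lambda>\<omega>. Re (ip (c \<omega>) (c \<omega>))" and ?W = "weights scaleV \<pi>"
  define f where "f t = (\<Sum>\<omega>\<in>?W. ?p \<omega> * exp (2 * (real_weight \<omega> \<bullet> (t *\<^sub>R h))))" for t
  have f: "(ipnorm ip (\<pi> (mexp (t *\<^sub>R eigen_matrix u h)) v))\<^sup>2 = f t" for t
    using norm_orbit[OF u u c v, of "t *\<^sub>R h"] by (simp add: f_def mexp_scaleR_eigen_matrix[OF u]) (simp add: eigen_matrix_def)
  have ln: "ln (ipnorm ip (\<pi> (mexp (t *\<^sub>R eigen_matrix u h)) v)) = ln (f t) / 2" for t
    using ipnorm_nonneg[of "\<pi> (mexp (t *\<^sub>R eigen_matrix u h)) v"]
    by (cases "ipnorm ip (\<pi> (mexp (t *\<^sub>R eigen_matrix u h)) v) = 0") (simp_all add: ln_realpow flip: f)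
  have f0: "f 0 = (ipnorm ip v)\<^sup>2" using sum_weight_components[OF u c v] by (simp add: f_def)
  have "(f has_real_derivative (\<Sum>\<omega>\<in>?W. ?p \<omega> * (2 * (real_weight \<omega> \<bullet> h)))) (at 0)"
    unfolding f_def by (auto intro!: derivative_eq_intros sum.cong)
  then have "((\<lambda>t. ln (f t) / 2) has_real_derivative
      (\<Sum>\<omega>\<in>?W. ?p \<omega> * (2 * (real_weight \<omega> \<bullet> h))) / (2 * f 0)) (at 0)"
    using ipnorm_pos[OF assms(1)] f0 by (intro half_ln_derivative) auto
  then have "moment_map ip \<pi> v \<bullet> eigen_matrix u h = (\<Sum>\<omega>\<in>?W. ?p \<omega> * (2 * (real_weight \<omega> \<bullet> h))) / (2 * f 0)"
    using DERIV_unique moment_map(2)[OF assms(1) eigen_matrix_Herm, of u h] unfolding ln by blast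
  also have "(\<Sum>\<omega>\<in>?W. ?p \<omega> * (2 * (real_weight \<omega> \<bullet> h))) = 2 * (\<Sum>\<omega>\<in>?W. ?p \<omega> * (real_weight \<omega> \<bullet> h))"
    by (simp add: sum_distrib_left mult_ac)
  finally show ?thesis by (simp add: f0)
qed

end

section \<open>Bounds on the capacity\<close>

text \<open>Induction on the support \<open>S\<close> of \<open>p\<close>. If \<open>0\<close> lies outside the convex hull of the points in the support,
  then \<open>\<parallel>\<Sum> p a\<parallel> \<ge> \<gamma> \<Sum> p\<close> and the left-hand side is at most \<open>0\<close>. Otherwise write \<open>0\<close> as a convex combination with
  coefficients \<open>c\<close> and subtract from \<open>p\<close> the largest multiple \<open>t c\<close> that keeps it nonnegative.
  The support shrinks, the vector \<open>\<Sum> p a\<close> is unchanged, the total mass drops by \<open>t\<close>, and by \<open>exp x \<ge> 1 + x\<close> the sum of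
  exponentials drops by at least \<open>t\<close>.\<close>
lemma exp_sum_lower_bound:
  fixes a :: "'i \<Rightarrow> 'b::euclidean_space"
  assumes W: "finite W" "inj_on a W" and "\<And>\<omega>. \<omega> \<in> W \<Longrightarrow> 0 \<le> p \<omega>" and \<gamma>: "\<gamma> > 0"
    and margin: "\<And>\<Gamma>. \<Gamma> \<subseteq> W \<Longrightarrow> \<Gamma> \<noteq> {} \<Longrightarrow> 0 \<notin> convex hull (a ` \<Gamma>)
      \<Longrightarrow> \<gamma> \<le> infdist 0 (convex hull (a ` \<Gamma>))"
  shows "(\<Sum>\<omega>\<in>W. p \<omega>) - norm (\<Sum>\<omega>\<in>W. p \<omega> *\<^sub>R a \<omega>) / \<gamma> \<le> (\<Sum>\<omega>\<in>W. p \<omega> * exp (a \<omega> \<bullet> h))"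
  using assms(3)
proof (induction "card {\<omega> \<in> W. p \<omega> \<noteq> 0}" arbitrary: p rule: less_induct)
  case less
  define S where "S = {\<omega> \<in> W. p \<omega> \<noteq> 0}"
  have S: "finite S" "S \<subseteq> W" using W by (auto simp: S_def)
  have pS: "p \<omega> > 0" if "\<omega> \<in> S" for \<omega> using less.prems[of \<omega>] that by (auto simp: S_def)
  have sum_p: "(\<Sum>\<omega>\<in>W. p \<omega>) = (\<Sum>\<omega>\<in>S. p \<omega>)" "(\<Sum>\<omega>\<in>W. p \<omega> *\<^sub>R a \<omega>) = (\<Sum>\<omega>\<in>S. p \<omega> *\<^sub>R a \<omega>)"
    using W by (auto intro!: sum.mono_neutral_right simp: S_def)
  have nonneg: "0 \<le> (\<Sum>\<omega>\<in>W. p \<omega> * exp (a \<omega> \<bullet> h))"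
    using less.prems by (intro sum_nonneg) simp
  consider "S = {}" | "S \<noteq> {}" "0 \<notin> convex hull (a ` S)" | "0 \<in> convex hull (a ` S)" by blast
  then show ?case
  proof cases
    case 1
    then show ?thesis using nonneg by (simp add: sum_p)
  next
    case 2
    define P where "P = (\<Sum>\<omega>\<in>S. p \<omega>)"
    have P: "P > 0" unfolding P_def using S 2 pS by (intro sum_pos) auto
    have "(\<Sum>\<omega>\<in>S. (p \<omega> / P) *\<^sub>R a \<omega>) \<in> convex hull (a ` S)"
    proof (rule convex_sum[OF S(1) convex_convex_hull])
      show "(\<Sum>\<omega>\<in>S. p \<omega> / P) = 1" using P by (simp add: P_def flip: sum_divide_distrib)
      show "0 \<le> p \<omega> / P" if "\<omega> \<in> S" for \<omega> using pS[OF that] P by simp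
      show "a \<omega> \<in> convex hull (a ` S)" if "\<omega> \<in> S" for \<omega> using that by (simp add: hull_inc)
    qed
    then have "infdist 0 (convex hull (a ` S)) \<le> norm (\<Sum>\<omega>\<in>S. (p \<omega> / P) *\<^sub>R a \<omega>)"
      using infdist_le[of _ "convex hull (a ` S)" 0] by simp
    also have "(\<Sum>\<omega>\<in>S. (p \<omega> / P) *\<^sub>R a \<omega>) = (1 / P) *\<^sub>R (\<Sum>\<omega>\<in>S. p \<omega> *\<^sub>R a \<omega>)"
      by (simp add: scaleR_sum_right)
    finally have "\<gamma> \<le> norm (\<Sum>\<omega>\<in>S. p \<omega> *\<^sub>R a \<omega>) / P"
      using margin[OF S(2) 2] P by simp
    then have "P \<le> norm (\<Sum>\<omega>\<in>S. p \<omega> *\<^sub>R a \<omega>) / \<gamma>" using P \<gamma> by (simp add: field_simps)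
    then show ?thesis using nonneg by (simp add: sum_p flip: P_def)
  next
    case 3
    then obtain q where q: "\<forall>x\<in>a ` S. 0 \<le> q x" "sum q (a ` S) = 1" "(\<Sum>x\<in>a ` S. q x *\<^sub>R x) = 0"
      using S(1) by (auto simp: convex_hull_finite)
    define c where "c \<omega> = (if \<omega> \<in> S then q (a \<omega>) else 0)" for \<omega>
    have inj: "inj_on a S" using W(2) S(2) by (rule inj_on_subset)
    have c_nonneg: "0 \<le> c \<omega>" for \<omega> using q(1) by (auto simp: c_def)
    have c_W: "(\<Sum>\<omega>\<in>W. c \<omega>) = 1" "(\<Sum>\<omega>\<in>W. c \<omega> *\<^sub>R a \<omega>) = 0"
    proof -
      have "(\<Sum>\<omega>\<in>W. c \<omega>) = (\<Sum>\<omega>\<in>S. q (a \<omega>))"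
        using W S by (intro sum.mono_neutral_cong_right) (auto simp: c_def)
      then show "(\<Sum>\<omega>\<in>W. c \<omega>) = 1" using q(2) by (simp add: sum.reindex[OF inj])
      have "(\<Sum>\<omega>\<in>W. c \<omega> *\<^sub>R a \<omega>) = (\<Sum>\<omega>\<in>S. q (a \<omega>) *\<^sub>R a \<omega>)"
        using W S by (intro sum.mono_neutral_cong_right) (auto simp: c_def)
      then show "(\<Sum>\<omega>\<in>W. c \<omega> *\<^sub>R a \<omega>) = 0" using q(3) by (simp add: sum.reindex[OF inj])
    qed
    have c_exp: "1 \<le> (\<Sum>\<omega>\<in>W. c \<omega> * exp (a \<omega> \<bullet> h))"
    proof -
      have "1 = (\<Sum>\<omega>\<in>W. c \<omega>) + (\<Sum>\<omega>\<in>W. c \<omega> *\<^sub>R a \<omega>) \<bullet> h" by (simp add: c_W)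
      also have "\<dots> = (\<Sum>\<omega>\<in>W. c \<omega> * (1 + a \<omega> \<bullet> h))"
        by (simp add: inner_sum_left distrib_left sum.distrib)
      also have "\<dots> \<le> (\<Sum>\<omega>\<in>W. c \<omega> * exp (a \<omega> \<bullet> h))"
        by (intro sum_mono mult_left_mono exp_ge_add_one_self c_nonneg)
      finally show ?thesis .
    qed
    define T where "T = {\<omega> \<in> S. c \<omega> > 0}"
    have "T \<noteq> {}"
    proof
      assume "T = {}"
      then have "c \<omega> = 0" for \<omega>
        using c_nonneg[of \<omega>] by (cases "\<omega> \<in> S") (auto simp: T_def c_def)
      then show False using c_W(1) by simp
    qed
    have T: "finite T" "T \<subseteq> S" using S by (auto simp: T_def)
    define t where "t = Min ((\<lambda>\<omega>. p \<omega> / c \<omega>) ` T)"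
    have "t \<in> (\<lambda>\<omega>. p \<omega> / c \<omega>) ` T" unfolding t_def using T \<open>T \<noteq> {}\<close> by (intro Min_in) auto
    then obtain \<omega>0 where \<omega>0: "\<omega>0 \<in> T" "t = p \<omega>0 / c \<omega>0" by blast
    have t_le: "t * c \<omega> \<le> p \<omega>" if "\<omega> \<in> W" for \<omega>
    proof (cases "\<omega> \<in> T")
      case True
      then have "t \<le> p \<omega> / c \<omega>" unfolding t_def using T by (intro Min_le) auto
      then show ?thesis using True by (simp add: T_def field_simps)
    next
      case False
      then have "c \<omega> = 0" using c_nonneg[of \<omega>] by (auto simp: T_def c_def)
      then show ?thesis using less.prems that by simp
    qed
    define p' where "p' \<omega> = p \<omega> - t * c \<omega>" for \<omega>
    have "p' \<omega>0 = 0" "\<omega>0 \<in> S" using \<omega>0 T by (auto simp: p'_def T_def)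
    moreover have "{\<omega> \<in> W. p' \<omega> \<noteq> 0} \<subseteq> S"
      by (auto simp: p'_def S_def c_def)
    ultimately have "{\<omega> \<in> W. p' \<omega> \<noteq> 0} \<subset> S" by blast
    then have card: "card {\<omega> \<in> W. p' \<omega> \<noteq> 0} < card {\<omega> \<in> W. p \<omega> \<noteq> 0}"
      using S(1) unfolding S_def[symmetric] by (rule psubset_card_mono[rotated])
    have "t \<ge> 0" using \<omega>0 pS T by (auto simp: T_def intro!: divide_nonneg_pos less_imp_le)
    have sums: "(\<Sum>\<omega>\<in>W. p \<omega>) = (\<Sum>\<omega>\<in>W. p' \<omega>) + t"
      "(\<Sum>\<omega>\<in>W. p \<omega> *\<^sub>R a \<omega>) = (\<Sum>\<omega>\<in>W. p' \<omega> *\<^sub>R a \<omega>)"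
      "(\<Sum>\<omega>\<in>W. p \<omega> * exp (a \<omega> \<bullet> h)) = (\<Sum>\<omega>\<in>W. p' \<omega> * exp (a \<omega> \<bullet> h)) + t * (\<Sum>\<omega>\<in>W. c \<omega> * exp (a \<omega> \<bullet> h))"
    proof -
      have "(\<Sum>\<omega>\<in>W. t * c \<omega>) = t" using c_W(1) by (simp flip: sum_distrib_left)
      then show "(\<Sum>\<omega>\<in>W. p \<omega>) = (\<Sum>\<omega>\<in>W. p' \<omega>) + t" by (simp add: p'_def sum_subtractf)
      have "(\<Sum>\<omega>\<in>W. (t * c \<omega>) *\<^sub>R a \<omega>) = 0"
        using c_W(2) by (simp flip: scaleR_scaleR scaleR_sum_right)
      then show "(\<Sum>\<omega>\<in>W. p \<omega> *\<^sub>R a \<omega>) = (\<Sum>\<omega>\<in>W. p' \<omega> *\<^sub>R a \<omega>)"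
        by (simp add: p'_def scaleR_left_diff_distrib sum_subtractf)
      show "(\<Sum>\<omega>\<in>W. p \<omega> * exp (a \<omega> \<bullet> h)) = (\<Sum>\<omega>\<in>W. p' \<omega> * exp (a \<omega> \<bullet> h)) + t * (\<Sum>\<omega>\<in>W. c \<omega> * exp (a \<omega> \<bullet> h))"
        by (simp add: p'_def left_diff_distrib sum_subtractf sum_distrib_left mult.assoc)
    qed
    have "(\<Sum>\<omega>\<in>W. p' \<omega>) - norm (\<Sum>\<omega>\<in>W. p' \<omega> *\<^sub>R a \<omega>) / \<gamma> \<le> (\<Sum>\<omega>\<in>W. p' \<omega> * exp (a \<omega> \<bullet> h))"
      using card t_le by (intro less.hyps) (auto simp: p'_def)
    moreover have "t \<le> t * (\<Sum>\<omega>\<in>W. c \<omega> * exp (a \<omega> \<bullet> h))"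
      using mult_left_mono[OF c_exp \<open>t \<ge> 0\<close>] by simp
    ultimately show ?thesis unfolding sums by linarith
  qed
qed

text \<open>The chord of \<open>exp\<close> over \<open>[- L, L]\<close>, evaluated at \<open>- y L\<close>.\<close>
lemma exp_convex_bound:
  fixes y L :: real
  assumes "\<bar>y\<bar> \<le> 1"
  shows "exp (- y * L) \<le> (1 + y) / 2 * exp (- L) + (1 - y) / 2 * exp L"
proof -
  have "exp ((1 - (1 + y) / 2) *\<^sub>R L + ((1 + y) / 2) *\<^sub>R (- L))
      \<le> (1 - (1 + y) / 2) * exp L + ((1 + y) / 2) * exp (- L)"
    using assms by (intro convex_onD[OF exp_convex]) auto
  moreover have "(1 - (1 + y) / 2) *\<^sub>R L + ((1 + y) / 2) *\<^sub>R (- L) = - y * L"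
    by (simp add: field_simps)
  moreover have "1 - (1 + y) / 2 = (1 - y) / 2" by (simp add: field_simps)
  ultimately show ?thesis by (simp add: add.commute)
qed

lemma inj_real_weight: "inj real_weight"
  by (auto simp: inj_def real_weight_def vec_eq_iff)

context unitary_rational_rep
begin

text \<open>The convexity bound applied to the weight decomposition of \<open>\<pi>(u\<^sup>*) v\<close>. The vector \<open>q\<close> is
  \<open>\<parallel>v\<parallel>\<^sup>2\<close> times the mean weight; pairing the moment map with \<open>q\<close> itself and Cauchy-Schwarz
  bound its length by \<open>\<parallel>v\<parallel>\<^sup>2 \<parallel>\<mu>(v)\<parallel>\<close>.\<close>
lemma orbit_norm_lower_bound:
  assumes "v \<noteq> 0" "g \<in> GL" and \<gamma>: "\<gamma> > 0"
    and margin: "\<And>\<Gamma>. \<Gamma> \<subseteq> weights scaleV \<pi> \<Longrightarrow> \<Gamma> \<noteq> {} \<Longrightarrow> 0 \<notin> convex hull (real_weight ` \<Gamma>)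
      \<Longrightarrow> \<gamma> \<le> infdist 0 (convex hull (real_weight ` \<Gamma>))"
  shows "(1 - norm (moment_map ip \<pi> v) / \<gamma>) * (ipnorm ip v)\<^sup>2 \<le> (ipnorm ip (\<pi> g v))\<^sup>2"
proof -
  obtain k h u where k: "k \<in> unitary_group" and u: "u \<in> unitary_group"
    and g: "g = k ** diag (\<chi> i. of_real (exp (h $ i))) ** conj_transpose u"
    using singular_value_decomposition[OF assms(2)] by blast
  obtain c where c: "\<And>\<omega>. c \<omega> \<in> weight_space scaleV \<pi> \<omega>"
    and v: "\<pi> (conj_transpose u) v = (\<Sum>\<omega>\<in>weights scaleV \<pi>. c \<omega>)"
    using weight_decomposition[of "\<pi> (conj_transpose u) v"] by blast
  define p where "p \<omega> = Re (ip (c \<omega>) (c \<omega>))" for \<omega>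
  define q where "q = (\<Sum>\<omega>\<in>weights scaleV \<pi>. p \<omega> *\<^sub>R real_weight \<omega>)"
  define m where "m = norm (moment_map ip \<pi> v)"
  define n where "n = (ipnorm ip v)\<^sup>2"
  have n: "n > 0" using ipnorm_pos[OF assms(1)] by (simp add: n_def)
  have "(\<Sum>\<omega>\<in>weights scaleV \<pi>. p \<omega>) - norm q / \<gamma>
      \<le> (\<Sum>\<omega>\<in>weights scaleV \<pi>. p \<omega> * exp (real_weight \<omega> \<bullet> (2 *\<^sub>R h)))"
    unfolding q_def using \<gamma> margin
    by (intro exp_sum_lower_bound finite_weights inj_on_subset[OF inj_real_weight])
       (auto simp: p_def Re_ip_self_nonneg)
  also have "\<dots> = (ipnorm ip (\<pi> g v))\<^sup>2"
    unfolding g norm_orbit[OF k u c v] p_def by simp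
  also have "(\<Sum>\<omega>\<in>weights scaleV \<pi>. p \<omega>) = n"
    using sum_weight_components[OF u c v] by (simp add: p_def n_def)
  finally have bound: "n - norm q / \<gamma> \<le> (ipnorm ip (\<pi> g v))\<^sup>2" .
  have "q \<bullet> q = n * (moment_map ip \<pi> v \<bullet> eigen_matrix u q)"
    using n unfolding moment_map_weights[OF assms(1) u c v] n_def[symmetric]
    by (simp add: q_def inner_sum_left p_def)
  also have "\<dots> \<le> n * (m * norm q)"
    using n norm_cauchy_schwarz[of "moment_map ip \<pi> v" "eigen_matrix u q"]
    by (simp add: m_def norm_eigen_matrix[OF u])
  finally have "norm q * norm q \<le> (n * m) * norm q" by (simp add: norm_eq_square flip: power2_norm_eq_inner power2_eq_square)
  then have "norm q \<le> n * m" using n by (cases "q = 0") (simp_all add: m_def)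
  then have "norm q / \<gamma> \<le> n * m / \<gamma>" using \<gamma> by (intro divide_right_mono) auto
  then show ?thesis using bound by (simp add: n_def[symmetric] m_def[symmetric] left_diff_distrib right_diff_distrib mult.commute)
qed

lemma capacity_le: "g \<in> GL \<Longrightarrow> capacity ip \<pi> v \<le> ipnorm ip (\<pi> g v)"
  unfolding capacity_def by (intro cINF_lower bdd_belowI2[of _ 0]) (simp_all add: ipnorm_nonneg)

lemma capacity_ge: "(\<And>g. g \<in> GL \<Longrightarrow> r \<le> ipnorm ip (\<pi> g v)) \<Longrightarrow> r \<le> capacity ip \<pi> v"
  unfolding capacity_def using mat_1_in_GL by (intro cINF_greatest) blast+

lemma capacity_power2_le: assumes "g \<in> GL" shows "(capacity ip \<pi> v)\<^sup>2 \<le> (ipnorm ip (\<pi> g v))\<^sup>2"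
  using capacity_le[OF assms] capacity_ge[of 0 v] ipnorm_nonneg by (intro power_mono) auto

lemma capacity_lower_bound:
  assumes "v \<noteq> 0" and \<gamma>: "\<gamma> > 0"
    and margin: "\<And>\<Gamma>. \<Gamma> \<subseteq> weights scaleV \<pi> \<Longrightarrow> \<Gamma> \<noteq> {} \<Longrightarrow> 0 \<notin> convex hull (real_weight ` \<Gamma>)
      \<Longrightarrow> \<gamma> \<le> infdist 0 (convex hull (real_weight ` \<Gamma>))"
  shows "1 - norm (moment_map ip \<pi> v) / \<gamma> \<le> (capacity ip \<pi> v)\<^sup>2 / (ipnorm ip v)\<^sup>2"
proof -
  define r where "r = (1 - norm (moment_map ip \<pi> v) / \<gamma>) * (ipnorm ip v)\<^sup>2"
  have "r \<le> (capacity ip \<pi> v)\<^sup>2"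
  proof (cases "r \<le> 0")
    case False
    have "sqrt r \<le> capacity ip \<pi> v"
    proof (rule capacity_ge)
      fix g :: "complex^'n^'n" assume "g \<in> GL"
      from orbit_norm_lower_bound[OF assms(1) this \<gamma> margin]
      have "r \<le> (ipnorm ip (\<pi> g v))\<^sup>2" by (simp add: r_def)
      then show "sqrt r \<le> ipnorm ip (\<pi> g v)" using ipnorm_nonneg by (rule real_le_lsqrt[rotated -1]) 
    qed
    then have "(sqrt r)\<^sup>2 \<le> (capacity ip \<pi> v)\<^sup>2" using False by (intro power_mono) auto
    then show ?thesis using False by simp
  qed (use zero_le_power2 order_trans in blast)
  then show ?thesis using ipnorm_pos[OF assms(1)] by (simp add: r_def field_simps)
qed

text \<open>Only finitely many \<open>\<Gamma>\<close> compete and each has a compact convex hull, so the infimum is attained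
  or, if there is no \<open>\<Gamma>\<close>, infinite. Positivity makes it a meaningful divisor.\<close>
lemma weight_margin_pos: "weight_margin scaleV \<pi> > 0"
proof -
  define G where "G = {\<Gamma>. \<Gamma> \<subseteq> weights scaleV \<pi> \<and> \<Gamma> \<noteq> {} \<and> 0 \<notin> convex hull (real_weight ` \<Gamma>)}"
  define f where "f \<Gamma> = ereal (infdist 0 (convex hull (real_weight ` \<Gamma>)))" for \<Gamma> :: "(int^'n) set"
  have wm: "weight_margin scaleV \<pi> = Inf (f ` G)" by (simp add: weight_margin_def G_def f_def)
  have fin: "finite (f ` G)"
    by (rule finite_imageI, rule finite_subset[of _ "Pow (weights scaleV \<pi>)"]) (auto simp: G_def finite_weights)
  have pos: "f \<Gamma> > 0" if "\<Gamma> \<in> G" for \<Gamma>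
  proof -
    have "finite \<Gamma>" using that finite_weights finite_subset by (auto simp: G_def)
    then have "closed (convex hull (real_weight ` \<Gamma>))"
      by (intro compact_imp_closed finite_imp_compact_convex_hull) auto
    then have "infdist 0 (convex hull (real_weight ` \<Gamma>)) \<noteq> 0"
      using that in_closed_iff_infdist_zero[of "convex hull (real_weight ` \<Gamma>)" 0] by (auto simp: G_def)
    then show ?thesis using infdist_nonneg[of 0 "convex hull (real_weight ` \<Gamma>)"] by (simp add: f_def)
  qed
  show ?thesis
  proof (cases "G = {}")
    case False
    then have "Inf (f ` G) \<in> f ` G" using fin by (simp add: cInf_eq_Min Min_in)
    then show ?thesis using pos by (auto simp: wm)
  qed (simp add: wm top_ereal_def)
qed

lemma capacity_weight_margin_bound:
  assumes "v \<noteq> 0"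
  shows "1 - ereal (norm (moment_map ip \<pi> v)) / weight_margin scaleV \<pi>
           \<le> ereal ((capacity ip \<pi> v)\<^sup>2 / (ipnorm ip v)\<^sup>2)"
proof -
  define m where "m = norm (moment_map ip \<pi> v)"
  define r where "r = (capacity ip \<pi> v)\<^sup>2 / (ipnorm ip v)\<^sup>2"
  have bound: "1 - m / \<gamma> \<le> r" if "\<gamma> > 0" "ereal \<gamma> \<le> weight_margin scaleV \<pi>" for \<gamma>
    unfolding m_def r_def
  proof (rule capacity_lower_bound[OF assms that(1)])
    fix \<Gamma> assume "\<Gamma> \<subseteq> weights scaleV \<pi>" "\<Gamma> \<noteq> {}" "0 \<notin> convex hull (real_weight ` \<Gamma>)"
    then have "weight_margin scaleV \<pi> \<le> ereal (infdist 0 (convex hull (real_weight ` \<Gamma>)))"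
      unfolding weight_margin_def by (intro INF_lower) auto
    then have "ereal \<gamma> \<le> ereal (infdist 0 (convex hull (real_weight ` \<Gamma>)))"
      using that(2) by (rule order_trans[rotated])
    then show "\<gamma> \<le> infdist 0 (convex hull (real_weight ` \<Gamma>))" by simp
  qed
  show ?thesis
  proof (cases "weight_margin scaleV \<pi>")
    case (real \<gamma>)
    then have "\<gamma> > 0" using weight_margin_pos by simp
    then show ?thesis using bound[of \<gamma>] real by (simp add: m_def r_def one_ereal_def)
  next
    case PInf
    \<comment> \<open>Every \<open>\<gamma> > 0\<close> is admissible, so the fraction can be made arbitrarily small.\<close>
    have "1 \<le> r"
    proof (rule field_le_epsilon)
      fix e :: real assume e: "e > 0"
      have m: "m \<ge> 0" by (simp add: m_def)
      have "1 - m / ((m + 1) / e) \<le> r" using bound[of "(m + 1) / e"] e m PInf by simp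
      moreover have "m / ((m + 1) / e) \<le> e" using e m by (simp add: field_simps)
      ultimately show "1 \<le> r + e" by linarith
    qed
    then show ?thesis using PInf by (simp add: r_def one_ereal_def)
  next
    case MInf
    then show ?thesis using weight_margin_pos by simp
  qed
qed

text \<open>The point of the orbit that witnesses the bound lies on the geodesic in direction \<open>- \<mu>(v)\<close>. Here
  \<open>y \<omega>\<close> is the normalized height of the weight \<open>\<omega>\<close> in the direction of \<open>\<mu>(v)\<close>; it lies in \<open>[-1, 1]\<close> and has mean
  \<open>x\<close>, so the chord bound can be averaged.\<close>
lemma capacity_upper_bound:
  assumes "v \<noteq> 0" and N: "\<And>\<omega>. \<omega> \<in> weights scaleV \<pi> \<Longrightarrow> norm (real_weight \<omega>) \<le> N"
  shows "(capacity ip \<pi> v)\<^sup>2 / (ipnorm ip v)\<^sup>2 \<le> 1 - (norm (moment_map ip \<pi> v))\<^sup>2 / (2 * N\<^sup>2)"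
proof -
  let ?W = "weights scaleV \<pi>"
  define n where "n = (ipnorm ip v)\<^sup>2"
  have n: "n > 0" using ipnorm_pos[OF assms(1)] by (simp add: n_def)
  obtain u m where u: "u \<in> unitary_group" and m: "moment_map ip \<pi> v = eigen_matrix u m"
    using Herm_diagonalizable[OF moment_map(1)[OF assms(1)]] by blast
  have norm_m: "norm (moment_map ip \<pi> v) = norm m" by (simp add: m norm_eigen_matrix[OF u])
  show ?thesis
  proof (cases "N = 0 \<or> m = 0")
    case True
    have "(capacity ip \<pi> v)\<^sup>2 \<le> n" using capacity_power2_le[of "mat 1" v] by (simp add: rep_one n_def)
    then show ?thesis using True n by (auto simp: norm_m n_def[symmetric])
  next
    case False
    obtain c where c: "\<And>\<omega>. c \<omega> \<in> weight_space scaleV \<pi> \<omega>"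
      and v: "\<pi> (conj_transpose u) v = (\<Sum>\<omega>\<in>?W. c \<omega>)"
      using weight_decomposition[of "\<pi> (conj_transpose u) v"] by blast
    define p where "p \<omega> = Re (ip (c \<omega>) (c \<omega>))" for \<omega>
    have p: "p \<omega> \<ge> 0" for \<omega> by (simp add: p_def Re_ip_self_nonneg)
    have sum_p: "(\<Sum>\<omega>\<in>?W. p \<omega>) = n"
      using sum_weight_components[OF u c v] by (simp add: p_def n_def)
    have "?W \<noteq> {}" using sum_p n by auto
    then have "N \<ge> 0" using N norm_ge_zero order_trans by blast
    then have "N > 0" using False by simp
    define x where "x = norm m / N"
    define y where "y \<omega> = (real_weight \<omega> \<bullet> m) / (N * norm m)" for \<omega>
    have "m \<bullet> m = (\<Sum>\<omega>\<in>?W. p \<omega> * (real_weight \<omega> \<bullet> m)) / n"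
      using moment_map_weights[OF assms(1) u c v, of m] by (simp add: m inner_eigen_matrix[OF u] p_def n_def)
    then have "(\<Sum>\<omega>\<in>?W. p \<omega> * (real_weight \<omega> \<bullet> m)) = n * (norm m)\<^sup>2"
      using n by (simp add: power2_norm_eq_inner)
    then have sum_y: "(\<Sum>\<omega>\<in>?W. p \<omega> * y \<omega>) = n * x"
      using False by (simp add: y_def x_def power2_eq_square flip: sum_divide_distrib)
    have "x \<ge> 0" using \<open>N > 0\<close> by (simp add: x_def)
    \<comment> \<open>The minimizer of the averaged bound, \<open>r\<^sup>2 = (1 + x) / (1 - x)\<close>, is infinite for \<open>x = 1\<close>; the
      simpler \<open>exp L = 1 + x\<close> suffices and is always finite.\<close>
    define L where "L = ln (1 + x)"
    have L: "exp L = 1 + x" "exp (- L) = 1 / (1 + x)"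
      using \<open>x \<ge> 0\<close> by (simp_all add: L_def exp_minus divide_inverse)
    \<comment> \<open>scaled so that \<open>2 \<langle>\<omega>, h\<rangle> = - y \<omega> L\<close>\<close>
    define h where "h = (- L / (2 * (N * norm m))) *\<^sub>R m"
    let ?g = "u ** diag (\<chi> i. of_real (exp (h $ i))) ** conj_transpose u"
    have "?g \<in> GL" using eigen_matrix_exp_in_GL[OF u, of h] by (simp add: eigen_matrix_def)
    then have "(capacity ip \<pi> v)\<^sup>2 \<le> (ipnorm ip (\<pi> ?g v))\<^sup>2" by (rule capacity_power2_le)
    also have "\<dots> = (\<Sum>\<omega>\<in>?W. p \<omega> * exp (- y \<omega> * L))"
      unfolding norm_orbit[OF u u c v] p_def[symmetric]
      using \<open>N > 0\<close> False by (intro sum.cong refl) (simp add: h_def y_def field_simps)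
    also have "\<dots> \<le> (\<Sum>\<omega>\<in>?W. p \<omega> * ((1 + y \<omega>) / 2 * exp (- L) + (1 - y \<omega>) / 2 * exp L))"
    proof (intro sum_mono mult_left_mono exp_convex_bound p)
      fix \<omega> assume "\<omega> \<in> ?W"
      have "\<bar>real_weight \<omega> \<bullet> m\<bar> \<le> norm (real_weight \<omega>) * norm m" by (rule Cauchy_Schwarz_ineq2)
      also have "\<dots> \<le> N * norm m" using N[OF \<open>\<omega> \<in> ?W\<close>] by (rule mult_right_mono) simp
      finally show "\<bar>y \<omega>\<bar> \<le> 1" using \<open>N > 0\<close> False by (simp add: y_def abs_mult)
    qed
    also have "\<dots> = ((\<Sum>\<omega>\<in>?W. p \<omega>) + (\<Sum>\<omega>\<in>?W. p \<omega> * y \<omega>)) / 2 * exp (- L)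
        + ((\<Sum>\<omega>\<in>?W. p \<omega>) - (\<Sum>\<omega>\<in>?W. p \<omega> * y \<omega>)) / 2 * exp L"
      by (simp add: sum.distrib[symmetric] sum_subtractf[symmetric] sum_distrib_right sum_divide_distrib)
         (simp add: algebra_simps add_divide_distrib diff_divide_distrib)
    also have "\<dots> = n * (1 - x\<^sup>2 / 2)"
      using \<open>x \<ge> 0\<close> unfolding sum_p sum_y L by (simp add: field_simps power2_eq_square)
    finally have "(capacity ip \<pi> v)\<^sup>2 / n \<le> 1 - x\<^sup>2 / 2" using n by (simp add: field_simps)
    then show ?thesis by (simp add: n_def norm_m x_def power_divide mult.commute)
  qed
qed

end

section \<open>Transvections and the Borel subgroup\<close>

definition transvection :: "'n \<Rightarrow> 'n \<Rightarrow> complex \<Rightarrow> complex^'n^'n"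
  where "transvection i j s = (\<chi> a b. (if a = b then 1 else 0) + (if a = i \<and> b = j then s else 0))"

lemma mult_transvection_component:
  "(A ** transvection i j s) $ a $ b = A $ a $ b + (if b = j then s * A $ a $ i else 0)"
proof -
  have "(A ** transvection i j s) $ a $ b
      = (\<Sum>k\<in>UNIV. (if k = b then A $ a $ k else 0) + (if k = i then (if b = j then s * A $ a $ k else 0) else 0))"
    unfolding matrix_matrix_mult_def transvection_def by (simp, intro sum.cong) (auto simp: distrib_left)
  then show ?thesis by (simp add: sum.distrib)
qed

lemma transvection_component:
  "transvection i j s $ a $ b = (if a = b then 1 else 0) + (if a = i \<and> b = j then s else 0)"
  by (simp add: transvection_def)

lemma transvection_0: "transvection i j 0 = mat 1"
  by (simp add: vec_eq_iff transvection_component mat_def)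

lemma transvection_add:
  "i \<noteq> j \<Longrightarrow> transvection i j s ** transvection i j t = transvection i j (s + t)"
  by (auto simp: vec_eq_iff mult_transvection_component) (auto simp: transvection_component)

lemma transvection_in_GL: "i \<noteq> j \<Longrightarrow> transvection i j s \<in> GL"
proof -
  assume "i \<noteq> j"
  then have "transvection i j s ** transvection i j (-s) = mat 1"
     "transvection i j (-s) ** transvection i j s = mat 1"
    by (simp_all add: transvection_add transvection_0)
  then show ?thesis unfolding GL_def invertible_def by blast
qed

lemma det_transvection:
  assumes "i \<noteq> j" shows "det (transvection i j s) = 1"
proof -
  have "transvection i j s = (\<chi> k. if k = i then row i (mat 1) + s *s row j (mat 1) else row k (mat 1))"
    using assms by (auto simp: vec_eq_iff transvection_component row_def mat_def)
  then show ?thesis using det_row_operation[OF assms, of "mat 1" s] by simp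
qed

lemma diag_mult_transvection:
  assumes "x \<in> torus" "i \<noteq> j"
  shows "diag x ** transvection i j s = transvection i j (x $ i / x $ j * s) ** diag x"
  using assms by (auto simp: vec_eq_iff transvection_component torus_def)

text \<open>Transvections have determinant \<open>1\<close>, so no denominators occur.\<close>
lemma gl_polynomial_transvection:
  assumes "gl_polynomial p" "i \<noteq> j"
  shows "\<exists>q. \<forall>s. p (transvection i j s) = poly q s"
  using assms(1)
proof induction
  case (const c)
  show ?case by (rule exI[of _ "[:c:]"]) simp
next
  case (entry a b)
  show ?case by (rule exI[of _ "[:if a = b then 1 else 0, if a = i \<and> b = j then 1 else 0:]"])
      (auto simp: transvection_component)
next
  case inverse_det
  show ?case by (rule exI[of _ 1]) (simp add: det_transvection[OF assms(2)])
next
  case (add p q)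
  then show ?case by (metis poly_add)
next
  case (mult p q)
  then show ?case by (metis poly_mult)
qed

definition gl_root :: "'n \<Rightarrow> 'n \<Rightarrow> int^'n"
  where "gl_root i j = axis i 1 - axis j 1"

lemma weight_char_gl_root_multiple:
  assumes "x \<in> torus" shows "weight_char (of_nat k * gl_root i j) x = (x $ i / x $ j) ^ k"
proof (induction k)
  case (Suc k)
  have "weight_char (gl_root i j + axis j 1) x = x $ i" by (simp add: gl_root_def weight_char_axis)
  then have "weight_char (gl_root i j) x = x $ i / x $ j"
    using assms by (simp add: weight_char_add weight_char_axis) (simp add: torus_def field_simps)
  then show ?case using Suc assms by (simp add: distrib_right weight_char_add)
qed (simp add: weight_char_0)

text \<open>\<open>\<parallel>\<omega> + k (e\<^sub>i - e\<^sub>j)\<parallel>\<^sup>2 = \<parallel>\<omega>\<parallel>\<^sup>2 + 2 k (\<omega>\<^sub>i - \<omega>\<^sub>j) + 2 k\<^sup>2\<close>.\<close>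
lemma norm_real_weight_root_string:
  fixes \<omega> :: "int^'n"
  assumes "i \<noteq> j" "\<omega> $ j \<le> \<omega> $ i" "k > 0"
  shows "norm (real_weight \<omega>) < norm (real_weight (\<omega> + of_nat k * gl_root i j))"
proof -
  define r :: "real^'n" where "r = axis i 1 - axis j 1"
  have "real_weight (\<omega> + of_nat k * gl_root i j) = real_weight \<omega> + real k *\<^sub>R r"
    by (simp add: vec_eq_iff real_weight_def gl_root_def r_def axis_def of_nat_index)
  moreover have "real_weight \<omega> \<bullet> r = real_of_int (\<omega> $ i - \<omega> $ j)"
    by (simp add: r_def inner_diff_right inner_axis real_weight_def)
  moreover have "r \<bullet> r = 2"
    using assms(1) by (simp add: r_def inner_diff_right inner_diff_left inner_axis_axis)
  ultimately have "(norm (real_weight (\<omega> + of_nat k * gl_root i j)))\<^sup>2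
      = (norm (real_weight \<omega>))\<^sup>2 + 2 * (real k * real_of_int (\<omega> $ i - \<omega> $ j)) + 2 * (real k)\<^sup>2"
    unfolding power2_norm_eq_inner
    by (simp add: inner_add_left inner_add_right inner_commute power2_eq_square)
  moreover have "0 \<le> real k * real_of_int (\<omega> $ i - \<omega> $ j)" using assms(2) by simp
  moreover have "0 < (real k)\<^sup>2" using assms(3) by simp
  ultimately have "(norm (real_weight \<omega>))\<^sup>2 < (norm (real_weight (\<omega> + of_nat k * gl_root i j)))\<^sup>2" by linarith
  then show ?thesis by (rule power_less_imp_less_base) simp
qed

text \<open>The Borel subgroup is generated by the torus and the transvections with \<open>i < j\<close>. Column operations
  remove the off-diagonal entries one by one. With \<open>i\<close> the least row that still has such an
  entry, column \<open>i\<close> is zero off the diagonal, so adding a multiple of it to column \<open>j\<close> changes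
  only the entry at \<open>(i, j)\<close>.\<close>
lemma borel_induct [consumes 1, case_names diag transvection]:
  fixes b :: "((complex, 'n::{finite,linorder}) vec, 'n) vec"
  assumes "b \<in> borel_subgroup"
    and diag: "\<And>x. x \<in> torus \<Longrightarrow> Q (diag x)"
    and step: "\<And>b i j s. b \<in> borel_subgroup \<Longrightarrow> Q b \<Longrightarrow> i < j \<Longrightarrow> Q (b ** transvection i j s)"
  shows "Q b"
  using assms(1)
proof (induction "card {(i, j). i \<noteq> j \<and> b $ i $ j \<noteq> 0}" arbitrary: b rule: less_induct)
  case less
  define D where "D = {(i, j). i \<noteq> j \<and> b $ i $ j \<noteq> 0}"
  have GL: "b \<in> GL" and upper: "\<And>i j. j < i \<Longrightarrow> b $ i $ j = 0"
    using less.prems by (auto simp: borel_subgroup_def)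
  have det: "det b \<noteq> 0" using GL by (simp add: GL_def invertible_det_nz)
  show ?case
  proof (cases "D = {}")
    case True
    then have b: "b = diag (\<chi> i. b $ i $ i)" by (auto simp: vec_eq_iff diag_component D_def)
    have "(\<Prod>i\<in>UNIV. b $ i $ i) \<noteq> 0" using det det_diag[of "\<chi> i. b $ i $ i"] b by simp
    then have "(\<chi> i. b $ i $ i) \<in> torus" by (simp add: torus_def)
    then show ?thesis using diag b by metis
  next
    case False
    define i where "i = Min (fst ` D)"
    have "i \<in> fst ` D" unfolding i_def using False by (intro Min_in) auto
    then obtain j where "(i, j) \<in> D" by auto
    then have j: "i \<noteq> j" "b $ i $ j \<noteq> 0" by (auto simp: D_def)
    then have "i < j" using upper[of j i] by force
    have column: "b $ a $ i = 0" if "a \<noteq> i" for a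
    proof (rule ccontr)
      assume "b $ a $ i \<noteq> 0"
      then have "a \<in> fst ` D" using that by (force simp: D_def)
      then have "i \<le> a" unfolding i_def by (intro Min_le) auto
      then have "i < a" using that by simp
      then show False using upper \<open>b $ a $ i \<noteq> 0\<close> by blast
    qed
    \<comment> \<open>otherwise column \<open>i\<close> would vanish altogether\<close>
    have "b $ i $ i \<noteq> 0"
    proof
      assume "b $ i $ i = 0"
      then have "b $ a $ i = 0" for a using column by (cases "a = i") auto
      then have "column i b = 0" by (simp add: column_def vec_eq_iff)
      then show False using det det_zero_column(1) by blast
    qed
    define s where "s = b $ i $ j / b $ i $ i"
    define b' where "b' = b ** transvection i j (- s)"
    have b': "b' $ a $ c = (if (a, c) = (i, j) then 0 else b $ a $ c)" for a c
      using column[of a] \<open>b $ i $ i \<noteq> 0\<close> by (auto simp: b'_def mult_transvection_component s_def)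
    have "b' \<in> borel_subgroup"
      using GL upper j(1) \<open>i < j\<close> transvection_in_GL[OF j(1)]
      by (auto simp: borel_subgroup_def b' b'_def[symmetric] intro: GL_mult[of b "transvection i j (- s)", folded b'_def])
    moreover have "card {(a, c). a \<noteq> c \<and> b' $ a $ c \<noteq> 0} < card D"
      using j by (intro psubset_card_mono) (auto simp: D_def b')
    ultimately have "Q b'" using less.hyps by (simp add: D_def)
    then have "Q (b' ** transvection i j s)" using \<open>b' \<in> borel_subgroup\<close> \<open>i < j\<close> by (intro step)
    also have "b' ** transvection i j s = b"
      using j(1) by (simp add: b'_def transvection_add transvection_0 flip: matrix_mul_assoc)
    finally show ?thesis .
  qed
qed

section \<open>Weights and highest weights\<close>

context hermitian_space
begin

lemma ip_zero_on_span:
  assumes "\<And>y. y \<in> B \<Longrightarrow> ip x y = 0" "y \<in> span B"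
  shows "ip x y = 0"
  using assms(2)
proof (induction rule: span_induct_alt)
  case (step c y z)
  then show ?case using assms(1) by (simp add: ip_add_right ip_scale_right)
qed simp

text \<open>Gram-Schmidt: the residue \<open>e\<close> of the new vector \<open>b\<close> is orthogonal to the old span.\<close>
lemma orthogonal_projection_span:
  assumes "finite B" shows "\<exists>p\<in>span B. \<forall>y\<in>B. ip (w - p) y = 0"
  using assms
proof (induction B arbitrary: w rule: finite_induct)
  case empty
  show ?case using span_zero by auto
next
  case (insert b B)
  obtain p where p: "p \<in> span B" "\<forall>y\<in>B. ip (w - p) y = 0" using insert.IH by blast
  obtain q where q: "q \<in> span B" "\<forall>y\<in>B. ip (b - q) y = 0" using insert.IH by blast
  define e where "e = b - q"
  have sub: "x \<in> span (insert b B)" if "x \<in> span B" for x using that span_mono[of B "insert b B"] by auto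
  have e_span: "e \<in> span (insert b B)" using sub q(1) by (auto simp: e_def intro: span_diff span_base)
  define p' where "p' = p + scaleV (ip (w - p) e / ip e e) e"
  have p'_B: "ip (w - p') y = 0" if "y \<in> B" for y
    using that p(2) q(2) by (simp add: p'_def e_def[symmetric] ip_diff_left ip_add_left ip_scale_left)
  have "ip (w - p') e = 0"
    by (cases "e = 0") (simp_all add: p'_def ip_diff_left ip_add_left ip_scale_left ip_self_eq_0)
  moreover have "ip (w - p') q = 0" using p'_B q(1) by (rule ip_zero_on_span)
  ultimately have "ip (w - p') b = 0" using ip_add_right[of "w - p'" e q] by (simp add: e_def)
  moreover have "p' \<in> span (insert b B)"
    unfolding p'_def using sub p(1) e_span by (intro span_add span_scale)
  ultimately show ?case using p'_B by (intro bexI[of _ p']) auto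
qed

lemma orthogonal_projection:
  assumes "subspace U"
  obtains p where "p \<in> U" "\<And>y. y \<in> U \<Longrightarrow> ip (w - p) y = 0"
proof -
  obtain B where B: "finite B" "span B = U" using basis_subspace_exists[OF assms] by metis
  then obtain p where "p \<in> U" "\<forall>y\<in>B. ip (w - p) y = 0" using orthogonal_projection_span[OF B(1), of w] by auto
  then show ?thesis using that ip_zero_on_span[of B "w - p"] B(2) by blast
qed

end

context unitary_rational_rep
begin

text \<open>Conjugation by \<open>diag x\<close> scales the parameter \<open>s\<close> of a transvection by \<open>x\<^sub>i / x\<^sub>j\<close>. Comparing the
  coefficients of \<open>s\<^sup>k\<close> in the polynomial orbit map shows that the \<open>k\<close>-th one has weight
  \<open>\<omega> + k (e\<^sub>i - e\<^sub>j)\<close>.\<close>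
lemma unipotent_orbit_expansion:
  assumes w: "w \<in> weight_space scaleV \<pi> \<omega>" and ij: "i \<noteq> j"
  obtains K c where "\<And>k. k \<le> K \<Longrightarrow> c k \<in> weight_space scaleV \<pi> (\<omega> + of_nat k * gl_root i j)"
    "\<And>s. \<pi> (transvection i j s) w = (\<Sum>k\<le>K. scaleV (s ^ k) (c k))"
proof -
  obtain P where P: "\<And>b. b \<in> Basis \<Longrightarrow> gl_polynomial (P b)"
    "\<And>g. g \<in> GL \<Longrightarrow> \<pi> g w = (\<Sum>b\<in>Basis. scaleV (P b g) b)"
    using rep_orbit_polynomial[of w] by blast
  obtain q where q: "\<And>b s. b \<in> Basis \<Longrightarrow> P b (transvection i j s) = poly (q b) s"
    using gl_polynomial_transvection[OF P(1) ij] by metis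
  define K where "K = Max (insert 0 ((\<lambda>b. degree (q b)) ` Basis))"
  have deg: "degree (q b) \<le> K" if "b \<in> Basis" for b
    using that finite_Basis by (simp add: K_def)
  define c where "c k = (\<Sum>b\<in>Basis. scaleV (coeff (q b) k) b)" for k
  have expand: "\<pi> (transvection i j s) w = (\<Sum>k\<le>K. scaleV (s ^ k) (c k))" for s
  proof -
    have "\<pi> (transvection i j s) w = (\<Sum>b\<in>Basis. \<Sum>k\<le>K. scaleV (s ^ k * coeff (q b) k) b)"
      unfolding P(2)[OF transvection_in_GL[OF ij]]
    proof (intro sum.cong refl)
      fix b assume b: "b \<in> Basis"
      have "poly (q b) s = (\<Sum>k\<le>K. coeff (q b) k * s ^ k)"
        unfolding poly_altdef using deg[OF b] by (intro sum.mono_neutral_left) (auto simp: coeff_eq_0)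
      then show "scaleV (P b (transvection i j s)) b = (\<Sum>k\<le>K. scaleV (s ^ k * coeff (q b) k) b)"
        by (simp add: q[OF b] scale_sum_left mult.commute)
    qed
    also have "\<dots> = (\<Sum>k\<le>K. scaleV (s ^ k) (c k))"
      by (subst sum.swap) (simp add: c_def scale_sum_right)
    finally show ?thesis .
  qed
  have "c k \<in> weight_space scaleV \<pi> (\<omega> + of_nat k * gl_root i j)" if k: "k \<le> K" for k
    unfolding weight_space_iff
  proof
    fix x :: "complex^'n" assume x: "x \<in> torus"
    then have GL: "diag x \<in> GL" by (rule diag_torus_in_GL)
    define r where "r = x $ i / x $ j"
    have "\<forall>k\<in>{..K}. \<pi> (diag x) (c k) - scaleV (weight_char \<omega> x * r ^ k) (c k) = 0"
    proof (rule characters_independent[of "{..K}" "{s. s \<noteq> 0}" "\<lambda>k s. s ^ k"])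
      fix s :: complex
      have "(\<Sum>k\<le>K. scaleV (s ^ k) (\<pi> (diag x) (c k))) = \<pi> (diag x ** transvection i j s) w"
        by (simp add: rep_mult_apply GL transvection_in_GL ij expand rep_sum rep_scale)
      also have "\<dots> = \<pi> (transvection i j (r * s) ** diag x) w"
        by (simp add: diag_mult_transvection x ij r_def)
      also have "\<dots> = scaleV (weight_char \<omega> x) (\<Sum>k\<le>K. scaleV ((r * s) ^ k) (c k))"
        by (simp add: rep_mult_apply[OF transvection_in_GL[OF ij] GL] weight_spaceD[OF w x]
            rep_scale[OF transvection_in_GL[OF ij]] expand)
      also have "\<dots> = (\<Sum>k\<le>K. scaleV (s ^ k) (scaleV (weight_char \<omega> x * r ^ k) (c k)))"
        by (simp add: scale_sum_right power_mult_distrib mult_ac)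
      finally show "(\<Sum>k\<le>K. scaleV (s ^ k) (\<pi> (diag x) (c k) - scaleV (weight_char \<omega> x * r ^ k) (c k))) = 0"
        by (simp add: scale_right_diff_distrib sum_subtractf)
    next
      fix k l :: nat assume "k \<noteq> l"
      then have "(2::complex) ^ k \<noteq> 2 ^ l"
        by (metis nat_power_eq_Suc_0_iff of_nat_eq_iff of_nat_numeral of_nat_power power_inject_exp
            numeral_One numeral_eq_iff one_less_numeral_iff semiring_norm(76))
      then show "\<exists>s\<in>{s::complex. s \<noteq> 0}. s ^ k \<noteq> s ^ l" by (intro bexI[of _ 2]) auto
    qed (auto simp: power_mult_distrib)
    then have "\<pi> (diag x) (c k) = scaleV (weight_char \<omega> x * r ^ k) (c k)" using k by simp
    then show "\<pi> (diag x) (c k) = scaleV (weight_char (\<omega> + of_nat k * gl_root i j) x) (c k)"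
      using x by (simp add: weight_char_add weight_char_gl_root_multiple r_def)
  qed
  then show ?thesis using expand that by blast
qed

text \<open>All terms of positive degree in \<open>s\<close> vanish, since their weights would be longer
  than \<open>\<omega>\<close>.\<close>
lemma longest_weight_unipotent_fixed:
  assumes w: "w \<in> weight_space scaleV \<pi> \<omega>" and ij: "i \<noteq> j" "\<omega> $ j \<le> \<omega> $ i"
    and max: "\<And>\<alpha>. \<alpha> \<in> weights scaleV \<pi> \<Longrightarrow> norm (real_weight \<alpha>) \<le> norm (real_weight \<omega>)"
  shows "\<pi> (transvection i j s) w = w"
proof -
  obtain K c where c: "\<And>k. k \<le> K \<Longrightarrow> c k \<in> weight_space scaleV \<pi> (\<omega> + of_nat k * gl_root i j)"
    and expand: "\<And>s. \<pi> (transvection i j s) w = (\<Sum>k\<le>K. scaleV (s ^ k) (c k))"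
    using unipotent_orbit_expansion[OF w ij(1)] by blast
  have "c k = 0" if "k \<in> {..K} - {0}" for k
  proof (rule ccontr)
    assume "c k \<noteq> 0"
    then have "\<omega> + of_nat k * gl_root i j \<in> weights scaleV \<pi>" using c[of k] that by (auto simp: weights_def)
    then show False using max norm_real_weight_root_string[OF ij, of k] that by fastforce
  qed
  then have "\<pi> (transvection i j s) w = c 0" for s
    unfolding expand by (subst sum.mono_neutral_right[of "{..K}" "{0}"]) auto
  from this[of s] this[of 0] show ?thesis by (simp add: transvection_0 rep_one)
qed

text \<open>By the singular value decomposition it is enough to treat unitary \<open>g\<close>, which preserve the inner
  product, and positive diagonal \<open>g\<close>. The latter act by self-adjoint maps because they scale the
  orthogonal weight spaces by real factors.\<close>
lemma orthogonal_complement_invariant: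
  assumes W: "subrepresentation scaleV \<pi> W" and g: "g \<in> GL" and x: "\<And>y. y \<in> W \<Longrightarrow> ip x y = 0"
    and "y \<in> W"
  shows "ip (\<pi> g x) y = 0"
proof -
  have W_inv: "\<pi> h y \<in> W" if "h \<in> GL" "y \<in> W" for h y
    using W that by (auto simp: subrepresentation_def)
  have unitary: "ip (\<pi> k x) y = 0"
    if x: "\<And>y. y \<in> W \<Longrightarrow> ip x y = 0" and k: "k \<in> unitary_group" and y: "y \<in> W" for k x y
  proof -
    have "\<pi> k (\<pi> (conj_transpose k) y) = y"
      using k by (simp add: rep_one unitary_in_GL unitary_conj_transpose unitary_group_def flip: rep_mult_apply)
    then have "ip (\<pi> k x) y = ip x (\<pi> (conj_transpose k) y)"
      using rep_unitary[OF k, of x "\<pi> (conj_transpose k) y"] by simp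
    then show ?thesis using x W_inv k y by (simp add: unitary_in_GL unitary_conj_transpose)
  qed
  have diag: "ip (\<pi> (diag (\<chi> i. of_real (exp (h $ i)))) x) y = 0"
    if x: "\<And>y. y \<in> W \<Longrightarrow> ip x y = 0" and y: "y \<in> W" for h x y
  proof -
    define d where "d = (\<chi> i. complex_of_real (exp (h $ i)))"
    have d: "d \<in> torus" by (simp add: d_def torus_def)
    have real: "weight_char \<omega> d = of_real (exp (real_weight \<omega> \<bullet> h))" for \<omega>
      by (simp only: d_def weight_char_exp)
    obtain b where b: "\<And>\<omega>. b \<omega> \<in> weight_space scaleV \<pi> \<omega>" and x_sum: "x = (\<Sum>\<omega>\<in>weights scaleV \<pi>. b \<omega>)"
      using weight_decomposition[of x] by blast
    obtain c where c: "\<And>\<omega>. c \<omega> \<in> weight_space scaleV \<pi> \<omega>" and y_sum: "y = (\<Sum>\<omega>\<in>weights scaleV \<pi>. c \<omega>)"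
      using weight_decomposition[of y] by blast
    have "ip (\<pi> (diag d) x) y = (\<Sum>\<alpha>\<in>weights scaleV \<pi>. \<Sum>\<beta>\<in>weights scaleV \<pi>. weight_char \<beta> d * ip (b \<beta>) (c \<alpha>))"
      unfolding x_sum y_sum using d weight_spaceD[OF b d]
      by (simp add: rep_sum diag_torus_in_GL ip_sum_left ip_sum_right ip_scale_left)
    also have "\<dots> = (\<Sum>\<alpha>\<in>weights scaleV \<pi>. \<Sum>\<beta>\<in>weights scaleV \<pi>. weight_char \<alpha> d * ip (b \<beta>) (c \<alpha>))"
      using weight_spaces_orthogonal[OF b c] by (intro sum.cong refl) (metis mult_zero_right)
    also have "\<dots> = ip x (\<pi> (diag d) y)"
      unfolding x_sum y_sum using d weight_spaceD[OF c d]
      by (simp add: rep_sum diag_torus_in_GL ip_sum_left ip_sum_right ip_scale_right real sum_distrib_left)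
    also have "\<dots> = 0" using x W_inv y d by (simp add: diag_torus_in_GL)
    finally show ?thesis by (simp add: d_def)
  qed
  obtain k h u where k: "k \<in> unitary_group" and u: "u \<in> unitary_group"
    and g_eq: "g = k ** diag (\<chi> i. of_real (exp (h $ i))) ** conj_transpose u"
    using singular_value_decomposition[OF g] by blast
  let ?d = "diag (\<chi> i. complex_of_real (exp (h $ i)))"
  have d: "?d \<in> GL" by (rule diag_in_GL) simp
  have "\<pi> g x = \<pi> k (\<pi> ?d (\<pi> (conj_transpose u) x))"
    using k u d by (simp add: g_eq rep_mult_apply GL_mult unitary_in_GL unitary_conj_transpose)
  then show ?thesis
    using unitary[OF diag[OF unitary[OF x unitary_conj_transpose[OF u]]] k \<open>y \<in> W\<close>] by simp
qed

lemma subrepresentation_orthogonal_complement: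
  assumes W: "subrepresentation scaleV \<pi> W" and U: "subrepresentation scaleV \<pi> U"
  shows "subrepresentation scaleV \<pi> {x \<in> W. \<forall>y\<in>U. ip x y = 0}"
  unfolding subrepresentation_def
proof (intro conjI ballI image_subsetI)
  have "subspace W" using W by (simp add: subrepresentation_def)
  then show "subspace {x \<in> W. \<forall>y\<in>U. ip x y = 0}"
    by (intro subspaceI)
       (auto simp: subspace_0 subspace_add subspace_scale ip_add_left ip_scale_left)
  fix g :: "complex^'n^'n" and x assume "g \<in> GL" "x \<in> {x \<in> W. \<forall>y\<in>U. ip x y = 0}"
  then show "\<pi> g x \<in> {x \<in> W. \<forall>y\<in>U. ip x y = 0}"
    using W orthogonal_complement_invariant[OF U] unfolding subrepresentation_def by blast
qed

text \<open>For a diagonal matrix, \<open>z = \<pi>(diag x) p - x\<^sup>\<omega> p\<close> lies in \<open>U\<close> and, being up to sign the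
  same expression for \<open>w - p\<close>, also in its orthogonal complement; hence \<open>z = 0\<close>.\<close>
lemma weight_vector_components:
  assumes w: "w \<in> weight_space scaleV \<pi> \<omega>" and U: "subrepresentation scaleV \<pi> U"
    and p: "p \<in> U" "\<And>y. y \<in> U \<Longrightarrow> ip (w - p) y = 0"
  shows "p \<in> weight_space scaleV \<pi> \<omega>" "w - p \<in> weight_space scaleV \<pi> \<omega>"
proof -
  have U_sub: "subspace U" and U_inv: "\<And>g x. g \<in> GL \<Longrightarrow> x \<in> U \<Longrightarrow> \<pi> g x \<in> U"
    using U by (auto simp: subrepresentation_def)
  have "\<pi> (diag x) p = scaleV (weight_char \<omega> x) p" if x: "x \<in> torus" for x
  proof -
    have GL: "diag x \<in> GL" using x by (rule diag_torus_in_GL)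
    define z where "z = \<pi> (diag x) p - scaleV (weight_char \<omega> x) p"
    have "z \<in> U" unfolding z_def using p(1) U_inv[OF GL] U_sub by (intro subspace_diff subspace_scale)
    have "z = scaleV (weight_char \<omega> x) (w - p) - \<pi> (diag x) (w - p)"
      using weight_spaceD[OF w x] by (simp add: z_def rep_diff[OF GL] scale_right_diff_distrib)
    then have "ip z z = weight_char \<omega> x * ip (w - p) z - ip (\<pi> (diag x) (w - p)) z"
      by (metis ip_diff_left ip_scale_left)
    also have "\<dots> = 0" using p(2) orthogonal_complement_invariant[OF U GL p(2)] \<open>z \<in> U\<close> by simp
    finally show ?thesis by (simp add: ip_self_eq_0 z_def)
  qed
  then show p_wt: "p \<in> weight_space scaleV \<pi> \<omega>" by (simp add: weight_space_iff)
  then show "w - p \<in> weight_space scaleV \<pi> \<omega>"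
    using w by (simp add: weight_space_iff rep_diff diag_torus_in_GL scale_right_diff_distrib)
qed

text \<open>Take \<open>W\<close> of least dimension among the subrepresentations in which the weight
  occurs. For a subrepresentation \<open>U \<subseteq> W\<close> the weight occurs in \<open>U\<close> or in its orthogonal complement in
  \<open>W\<close>, and whichever it is must be all of \<open>W\<close>.\<close>
lemma irreducible_subrep_with_weight:
  assumes "\<omega> \<in> weights scaleV \<pi>"
  obtains W w where "irreducible_subrep scaleV \<pi> W" "w \<in> W" "w \<noteq> 0" "w \<in> weight_space scaleV \<pi> \<omega>"
proof -
  define P where "P W \<longleftrightarrow> subrepresentation scaleV \<pi> W \<and> (\<exists>w\<in>W. w \<noteq> 0 \<and> w \<in> weight_space scaleV \<pi> \<omega>)" for W
  have "P UNIV" using assms by (auto simp: P_def subrepresentation_def weights_def)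
  then obtain W where W: "P W" and least: "\<And>U. P U \<Longrightarrow> dim W \<le> dim U"
    using ex_has_least_nat[of P UNIV dim] by blast
  then obtain w where w: "w \<in> W" "w \<noteq> 0" "w \<in> weight_space scaleV \<pi> \<omega>" and subrep: "subrepresentation scaleV \<pi> W"
    by (auto simp: P_def)
  have W_sub: "subspace W" using subrep by (simp add: subrepresentation_def)
  have whole: "U = W" if "P U" "U \<subseteq> W" for U
    using that least[of U] W_sub subspace_dim_equal[of U W] by (simp add: P_def subrepresentation_def)
  have "U = {0} \<or> U = W" if U: "subrepresentation scaleV \<pi> U" "U \<subseteq> W" for U
  proof -
    have U_sub: "subspace U" using U(1) by (simp add: subrepresentation_def)
    obtain p where p: "p \<in> U" "\<And>y. y \<in> U \<Longrightarrow> ip (w - p) y = 0" using orthogonal_projection[OF U_sub] by blast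
    note wt = weight_vector_components[OF w(3) U(1) p]
    show ?thesis
    proof (cases "p = 0")
      case False
      then show ?thesis using whole[of U] U p(1) wt(1) by (auto simp: P_def)
    next
      case True
      let ?C = "{x \<in> W. \<forall>y\<in>U. ip x y = 0}"
      have "P ?C" unfolding P_def
        using subrepresentation_orthogonal_complement[OF subrep U(1)] w p(2) True by auto
      then have "?C = W" by (rule whole) auto
      then have "ip x x = 0" if "x \<in> U" for x using that U(2) by blast
      then have "U = {0}" using subspace_0[OF U_sub] by (auto simp: ip_self_eq_0)
      then show ?thesis ..
    qed
  qed
  then have "irreducible_subrep scaleV \<pi> W" using subrep w by (auto simp: irreducible_subrep_def)
  then show ?thesis using that w by blast
qed

text \<open>The permutation matrix \<open>M\<close> of a transposition normalizes the torus, hence permutes the weight spaces.\<close>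
lemma weights_swap:
  assumes "\<omega> \<in> weights scaleV \<pi>"
  shows "(\<chi> a. \<omega> $ Transposition.transpose i j a) \<in> weights scaleV \<pi>"
proof -
  let ?t = "Transposition.transpose i j"
  define M :: "complex^'n^'n" where "M = (\<chi> a b. if b = ?t a then 1 else 0)"
  have M_left: "(M ** A) $ a $ b = A $ ?t a $ b" for A :: "complex^'n^'n" and a b
    by (simp add: M_def matrix_matrix_mult_def if_distrib[of "\<lambda>c. c * _"] cong: if_cong)
  have "M ** M = mat 1"
    by (auto simp: vec_eq_iff M_left) (auto simp: M_def mat_def)
  then have M: "M \<in> GL" unfolding GL_def invertible_def by blast
  obtain w where w: "w \<in> weight_space scaleV \<pi> \<omega>" "w \<noteq> 0" using assms by (auto simp: weights_def)
  have "\<pi> (diag x) (\<pi> M w) = scaleV (weight_char (\<chi> a. \<omega> $ ?t a) x) (\<pi> M w)" if x: "x \<in> torus" for x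
  proof -
    define y where "y = (\<chi> a. x $ ?t a)"
    have y: "y \<in> torus" using x by (simp add: torus_def y_def)
    have "diag x ** M = M ** diag y"
      by (auto simp: vec_eq_iff y_def) (auto simp: M_def)
    then have "\<pi> (diag x) (\<pi> M w) = \<pi> M (\<pi> (diag y) w)"
      using M x y by (simp add: diag_torus_in_GL flip: rep_mult_apply)
    also have "\<dots> = scaleV (weight_char \<omega> y) (\<pi> M w)"
      using w(1) y M by (simp add: weight_spaceD rep_scale)
    also have "weight_char \<omega> y = weight_char (\<chi> a. \<omega> $ ?t a) x"
      unfolding weight_char_def
      by (rule prod.reindex_bij_witness[of _ ?t ?t]) (simp_all add: y_def)
    finally show ?thesis .
  qed
  then have "\<pi> M w \<in> weight_space scaleV \<pi> (\<chi> a. \<omega> $ ?t a)"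
    unfolding weight_space_iff by (rule ballI)
  moreover have "\<pi> M w \<noteq> 0"
    using rep_bij[OF M] w(2) rep_0[OF M] by (metis bij_is_inj injD)
  ultimately show ?thesis unfolding weights_def by blast
qed

lemma norm_real_weight_swap:
  "norm (real_weight (\<chi> a. \<omega> $ Transposition.transpose i j a)) = norm (real_weight \<omega>)"
proof -
  have "(\<Sum>a\<in>UNIV. (real_of_int (\<omega> $ Transposition.transpose i j a))\<^sup>2) = (\<Sum>a\<in>UNIV. (real_of_int (\<omega> $ a))\<^sup>2)"
    by (rule sum.reindex_bij_witness[of _ "Transposition.transpose i j" "Transposition.transpose i j"]) simp_all
  then show ?thesis by (simp add: norm_vec_def L2_set_def real_weight_def)
qed

end

text \<open>Among the weights of maximal length choose one that maximizes \<open>\<rho> \<omega> = \<Sum>\<^sub>a c\<^sub>a \<omega>\<^sub>a\<close> with strictly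
  decreasing \<open>c\<close>. If \<open>\<omega>\<^sub>i < \<omega>\<^sub>j\<close> for some \<open>i < j\<close>, then swapping these coordinates would raise \<open>\<rho>\<close> by
  \<open>(c\<^sub>i - c\<^sub>j) (\<omega>\<^sub>j - \<omega>\<^sub>i) > 0\<close>.\<close>
lemma longest_dominant_weight:
  fixes scaleV :: "complex \<Rightarrow> 'v::ab_group_add \<Rightarrow> 'v" and Basis :: "'v set"
    and \<pi> :: "((complex, 'n::{finite,linorder}) vec, 'n) vec \<Rightarrow> 'v::ab_group_add \<Rightarrow> 'v"
  assumes "unitary_rational_rep scaleV Basis ip \<pi>" "\<alpha> \<in> weights scaleV \<pi>"
  obtains \<omega> where "\<omega> \<in> weights scaleV \<pi>"
    "\<And>\<beta>. \<beta> \<in> weights scaleV \<pi> \<Longrightarrow> norm (real_weight \<beta>) \<le> norm (real_weight \<omega>)"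
    "\<And>i j. i < j \<Longrightarrow> \<omega> $ j \<le> \<omega> $ i"
proof -
  interpret unitary_rational_rep scaleV Basis ip \<pi> by (rule assms(1))
  have "Max ((\<lambda>\<beta>. norm (real_weight \<beta>)) ` weights scaleV \<pi>) \<in> (\<lambda>\<beta>. norm (real_weight \<beta>)) ` weights scaleV \<pi>"
    using finite_weights assms(2) by (intro Max_in) auto
  then obtain \<omega>0 where \<omega>0: "\<omega>0 \<in> weights scaleV \<pi>"
      "norm (real_weight \<omega>0) = Max ((\<lambda>\<beta>. norm (real_weight \<beta>)) ` weights scaleV \<pi>)"
    by (elim imageE) simp
  have max0: "norm (real_weight \<beta>) \<le> norm (real_weight \<omega>0)" if "\<beta> \<in> weights scaleV \<pi>" for \<beta>
    unfolding \<omega>0(2) using finite_weights that by (intro Max_ge) auto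
  define S where "S = {\<beta> \<in> weights scaleV \<pi>. norm (real_weight \<beta>) = norm (real_weight \<omega>0)}"
  \<comment> \<open>any strictly decreasing sequence of integers would do\<close>
  define c :: "'n \<Rightarrow> int" where "c a = int (card {b. a \<le> b})" for a
  define \<rho> where "\<rho> \<beta> = (\<Sum>a\<in>UNIV. c a * \<beta> $ a)" for \<beta>
  have S: "finite S" "S \<noteq> {}" using \<omega>0(1) finite_weights by (auto simp: S_def)
  have "Max (\<rho> ` S) \<in> \<rho> ` S" using S by (intro Max_in) auto
  then obtain \<omega> where \<omega>: "\<omega> \<in> S" "\<rho> \<omega> = Max (\<rho> ` S)" by (elim imageE) simp
  have "\<omega> $ j \<le> \<omega> $ i" if ij: "i < j" for i j
  proof (rule ccontr)
    assume less: "\<not> \<omega> $ j \<le> \<omega> $ i"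
    define \<beta> where "\<beta> = (\<chi> a. \<omega> $ Transposition.transpose i j a)"
    have "\<beta> \<in> weights scaleV \<pi>" "norm (real_weight \<beta>) = norm (real_weight \<omega>)"
      using \<omega>(1) weights_swap norm_real_weight_swap unfolding S_def \<beta>_def by blast+
    then have "\<beta> \<in> S" using \<omega>(1) by (simp add: S_def)
    then have le: "\<rho> \<beta> \<le> \<rho> \<omega>" unfolding \<omega>(2) using S by (intro Max_ge) auto
    have "\<rho> \<beta> - \<rho> \<omega> = (\<Sum>a\<in>UNIV. c a * (\<beta> $ a - \<omega> $ a))"
      by (simp add: \<rho>_def sum_subtractf right_diff_distrib)
    also have "\<dots> = (\<Sum>a\<in>{i, j}. c a * (\<beta> $ a - \<omega> $ a))"
      by (rule sum.mono_neutral_right) (auto simp: \<beta>_def Transposition.transpose_def)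
    also have "\<dots> = (c i - c j) * (\<omega> $ j - \<omega> $ i)"
      using ij by (simp add: \<beta>_def algebra_simps)
    finally have diff: "\<rho> \<beta> - \<rho> \<omega> = (c i - c j) * (\<omega> $ j - \<omega> $ i)" .
    have "c j < c i"
    proof -
      have "card {b. j \<le> b} < card {b. i \<le> b}"
      proof (rule psubset_card_mono)
        have "i \<in> {b. i \<le> b}" "i \<notin> {b. j \<le> b}" using ij by auto
        then show "{b. j \<le> b} \<subset> {b. i \<le> b}" using ij by (auto intro: order_trans less_imp_le)
      qed simp
      then show ?thesis by (simp add: c_def)
    qed
    then show False using le diff less mult_pos_pos[of "c i - c j" "\<omega> $ j - \<omega> $ i"] by linarith
  qed
  then show ?thesis using that[of \<omega>] \<omega>(1) max0 by (auto simp: S_def)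
qed

text \<open>The longest dominant weight is the highest weight of an irreducible subrepresentation. Highest
  weights are weights, so the maximum in the definition of the weight norm ranges over a finite set.\<close>
lemma weight_norm_bound:
  fixes scaleV :: "complex \<Rightarrow> 'v::ab_group_add \<Rightarrow> 'v" and Basis :: "'v set"
    and \<pi> :: "((complex, 'n::{finite,linorder}) vec, 'n) vec \<Rightarrow> 'v::ab_group_add \<Rightarrow> 'v"
  assumes rep: "unitary_rational_rep scaleV Basis ip \<pi>" and "\<alpha> \<in> weights scaleV \<pi>"
  shows "norm (real_weight \<alpha>) \<le> weight_norm scaleV \<pi>"
proof -
  interpret unitary_rational_rep scaleV Basis ip \<pi> by (rule rep)
  obtain \<omega> where \<omega>: "\<omega> \<in> weights scaleV \<pi>"
    and max: "\<And>\<beta>. \<beta> \<in> weights scaleV \<pi> \<Longrightarrow> norm (real_weight \<beta>) \<le> norm (real_weight \<omega>)"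
    and dominant: "\<And>i j. i < j \<Longrightarrow> \<omega> $ j \<le> \<omega> $ i"
    using longest_dominant_weight[OF assms] by blast
  obtain W w where W: "irreducible_subrep scaleV \<pi> W"
    and w: "w \<in> W" "w \<noteq> 0" "w \<in> weight_space scaleV \<pi> \<omega>"
    using irreducible_subrep_with_weight[OF \<omega>] by blast
  have "\<pi> b w = scaleV (\<Prod>i\<in>UNIV. (b $ i $ i) powi (\<omega> $ i)) w" if "b \<in> borel_subgroup" for b
    using that
  proof (induction b rule: borel_induct)
    case (diag x)
    then show ?case using weight_spaceD[OF w(3)] by (simp add: weight_char_def diag_component)
  next
    case (transvection b i j s)
    have "b \<in> GL" "b $ j $ i = 0" using transvection by (auto simp: borel_subgroup_def)
    moreover have "i \<noteq> j" using \<open>i < j\<close> by simp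
    moreover have "\<pi> (transvection i j s) w = w"
      using longest_weight_unipotent_fixed[OF w(3) \<open>i \<noteq> j\<close> dominant[OF \<open>i < j\<close>] max] by simp
    ultimately have "\<pi> (b ** transvection i j s) w = \<pi> b w"
      by (simp add: rep_mult_apply transvection_in_GL)
    moreover have "(b ** transvection i j s) $ a $ a = b $ a $ a" for a
      using \<open>b $ j $ i = 0\<close> by (simp add: mult_transvection_component)
    ultimately show ?case using transvection.IH by simp
  qed
  then have highest: "is_highest_weight scaleV \<pi> W \<omega>"
    unfolding is_highest_weight_def using w by blast
  let ?X = "{norm (real_weight l) | l. \<exists>W. irreducible_subrep scaleV \<pi> W \<and> is_highest_weight scaleV \<pi> W l}"
  have "l \<in> weights scaleV \<pi>" if "is_highest_weight scaleV \<pi> W l" for W l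
  proof -
    from that obtain w where "w \<noteq> 0 \<and> (\<forall>b\<in>borel_subgroup.
        \<pi> b w = scaleV (\<Prod>i\<in>UNIV. (b $ i $ i) powi (l $ i)) w)"
      unfolding is_highest_weight_def by (rule bexE)
    then have w: "w \<noteq> 0" and eig: "\<forall>b\<in>borel_subgroup.
        \<pi> b w = scaleV (\<Prod>i\<in>UNIV. (b $ i $ i) powi (l $ i)) w"
      by (rule conjunct1, rule conjunct2)
    have "\<pi> (diag x) w = scaleV (weight_char l x) w" if "x \<in> torus" for x
      using bspec[OF eig, of "diag x"] that diag_torus_in_GL[OF that]
      by (simp add: borel_subgroup_def diag_component weight_char_def)
    then have "w \<in> weight_space scaleV \<pi> l" by (simp add: weight_space_iff)
    then show ?thesis using w unfolding weights_def by blast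
  qed
  then have "?X \<subseteq> (\<lambda>l. norm (real_weight l)) ` weights scaleV \<pi>" by blast
  then have "finite ?X" using finite_weights by (rule finite_subset[OF _ finite_imageI])
  moreover have "norm (real_weight \<omega>) \<in> ?X" using W highest by blast
  ultimately have "norm (real_weight \<omega>) \<le> weight_norm scaleV \<pi>"
    unfolding weight_norm_def by (rule Max_ge)
  then show ?thesis using max[OF assms(2)] by linarith
qed

section \<open>The capacity and the moment map\<close>

theorem theorem1p17:
  fixes scaleV :: "complex \<Rightarrow> 'v::ab_group_add \<Rightarrow> 'v"
    and Basis :: "'v set"
    and ip :: "'v \<Rightarrow> 'v \<Rightarrow> complex"
    and \<pi> :: "((complex, 'n::{finite,linorder}) vec, 'n) vec \<Rightarrow> 'v \<Rightarrow> 'v"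
    and v :: 'v
  assumes "unitary_rational_rep scaleV Basis ip \<pi>"
    and "v \<noteq> 0"
  shows "1 - ereal (norm (moment_map ip \<pi> v)) / weight_margin scaleV \<pi>
           \<le> ereal ((capacity ip \<pi> v)\<^sup>2 / (ipnorm ip v)\<^sup>2)
       \<and> (capacity ip \<pi> v)\<^sup>2 / (ipnorm ip v)\<^sup>2
           \<le> 1 - (norm (moment_map ip \<pi> v))\<^sup>2 / (4 * (weight_norm scaleV \<pi>)\<^sup>2)"
proof
  interpret unitary_rational_rep scaleV Basis ip \<pi> by (rule assms(1))
  show "1 - ereal (norm (moment_map ip \<pi> v)) / weight_margin scaleV \<pi>
           \<le> ereal ((capacity ip \<pi> v)\<^sup>2 / (ipnorm ip v)\<^sup>2)"
    using assms(2) by (rule capacity_weight_margin_bound)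
  let ?m = "(norm (moment_map ip \<pi> v))\<^sup>2" and ?N = "(weight_norm scaleV \<pi>)\<^sup>2"
  have "(capacity ip \<pi> v)\<^sup>2 / (ipnorm ip v)\<^sup>2 \<le> 1 - ?m / (2 * ?N)"
    using assms(2) weight_norm_bound[OF assms(1)] by (rule capacity_upper_bound)
  also have "\<dots> \<le> 1 - ?m / (4 * ?N)"
    by (cases "?N = 0") (auto intro!: divide_left_mono mult_pos_pos)
  finally show "(capacity ip \<pi> v)\<^sup>2 / (ipnorm ip v)\<^sup>2 \<le> 1 - ?m / (4 * ?N)" .
qed

end
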